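(* Let $h\in\mathbb{R}[x_1,\dots,x_n]$ be hyperbolic with respect to $\mathbf{e}\in\mathbb{R}^n$, let $V_1,\dots,V_m$ be finite sets of vectors in $\Lambda_+(h,\mathbf{e})$, and let $\mathbf{w}\in\mathbb{R}^{n+m}$. For $\mathbf{V}=(\mathbf{v}_1,\dots,\mathbf{v}_m)\in V_1\times\cdots\times V_m$ let $f(\mathbf{V};t):=h[\mathbf{v}_1,\dots,\mathbf{v}_m](t\mathbf{e}+\mathbf{w})$, where $t\mathbf{e}$ denotes $(t\mathbf{e},0,\dots,0)\in\mathbb{R}^{n+m}$. Then $\{f(\mathbf{V};t)\}_{\mathbf{V}\in V_1\times\cdots\times V_m}$ is a compatible family. In particular, if in addition all vectors in $V_1\cup\cdots\cup V_m$ have rank at most one, and $g(\mathbf{V};t):=h(t\mathbf{e}+\mathbf{w}-\alpha_1\mathbf{v}_1-\cdots-\alpha_m\mathbf{v}_m)$ with $\mathbf{w}\in\mathbb{R}^n$ and $(\alpha_1,\dots,\alpha_m)\in\mathbb{R}^m$, then $\{g(\mathbf{V};t)\}_{\mathbf{V}\in V_1\times\cdots\times V_m}$ is a compatible family.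
   Context: $h$ homogeneous of degree $d$ is hyperbolic with respect to $\mathbf{e}$ if $h(\mathbf{e})\neq0$ and $t\mapsto h(t\mathbf{e}-\mathbf{x})$ has only real zeros for all $\mathbf{x}$; write $h(t\mathbf{e}-\mathbf{x})=h(\mathbf{e})\prod_{j=1}^d(t-\lambda_j(\mathbf{x}))$, $\Lambda_+(h,\mathbf{e})=\{\mathbf{x}:\min_j\lambda_j(\mathbf{x})\geq0\}$, $\operatorname{rk}(\mathbf{x})=\#\{j:\lambda_j(\mathbf{x})\neq0\}$. $D_{\mathbf{v}}h=\sum_kv_k\partial h/\partial x_k$; $h[\mathbf{v}_1,\dots,\mathbf{v}_m]=\prod_{j=1}^m(1-y_jD_{\mathbf{v}_j})h(\mathbf{x})\in\mathbb{R}[x_1,\dots,x_n,y_1,\dots,y_m]$. A univariate real polynomial is real-rooted if it is identically zero or has only real zeros. For finite sets $S_1,\dots,S_m$, a family $\{f(\mathbf{s};t)\}_{\mathbf{s}\in S_1\times\cdots\times S_m}\subset\mathbb{R}[t]$ is compatible if all its nonzero members have the same degree and the same sign of leading coefficient, and for every choice of independent random variables $X_1\in S_1,\dots,X_m\in S_m$ the polynomial $\mathbb{E}f(X_1,\dots,X_m;t)$ is real-rooted. *)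

theory Defs
  imports
    "HOL-Probability.Probability"
    "HOL-Library.Poly_Mapping"
    "HOL-Computational_Algebra.Computational_Algebra"
begin

text \<open>
  Real polynomials in commuting variables indexed by \<^typ>\<open>'v\<close>: finitely supported maps from
  exponent vectors to coefficients, with the ring structure of \<^theory>\<open>HOL-Library.Poly_Mapping\<close>.
  For \<open>'v = 'n\<close> this is $\mathbb{R}[x_1,\dots,x_n]$, and for \<open>'v = 'n + 'm\<close> it is
  $\mathbb{R}[x_1,\dots,x_n,y_1,\dots,y_m]$, where \<open>Inl k\<close> indexes $x_k$ and \<open>Inr j\<close> indexes $y_j$.
\<close>
type_synonym 'v rpoly = "('v \<Rightarrow>\<^sub>0 nat) \<Rightarrow>\<^sub>0 real"

definition mconst :: "real \<Rightarrow> 'v rpoly"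
  where "mconst c = Poly_Mapping.single 0 c"

definition mvar :: "'v \<Rightarrow> 'v rpoly"
  where "mvar i = Poly_Mapping.single (Poly_Mapping.single i 1) 1"

text \<open>
  Substitution \<open>x\<^sub>i := \<phi> i\<close> in a commutative ring that receives the coefficients through \<open>c\<close>.
\<close>
definition msubst :: "(real \<Rightarrow> 'b::comm_ring_1) \<Rightarrow> ('v \<Rightarrow> 'b) \<Rightarrow> 'v rpoly \<Rightarrow> 'b"
  where "msubst c \<phi> p = (\<Sum>a\<in>Poly_Mapping.keys p.
           c (Poly_Mapping.lookup p a) *
           (\<Prod>i\<in>Poly_Mapping.keys a. \<phi> i ^ Poly_Mapping.lookup a i))"

definition meval :: "'v::finite rpoly \<Rightarrow> real ^ 'v \<Rightarrow> real"
  where "meval p x = msubst (\<lambda>a. a) (\<lambda>i. x $ i) p"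

text \<open>\<open>along p a b\<close> is the univariate polynomial $p(t\,b + a) \in \mathbb{R}[t]$.\<close>
definition along :: "'v::finite rpoly \<Rightarrow> real ^ 'v \<Rightarrow> real ^ 'v \<Rightarrow> real poly"
  where "along p a b = msubst (\<lambda>r. [:r:]) (\<lambda>i. [:a $ i, b $ i:]) p"

definition homogeneous :: "nat \<Rightarrow> 'v rpoly \<Rightarrow> bool"
  where "homogeneous d p \<longleftrightarrow>
    (\<forall>a\<in>Poly_Mapping.keys p. (\<Sum>i\<in>Poly_Mapping.keys a. Poly_Mapping.lookup a i) = d)"

text \<open>
  When the exponent of \<open>i\<close> in \<open>a\<close> is zero, the truncated subtraction leaves \<open>a\<close> unchanged, but the
  coefficient is then zero.
\<close>
definition mpderiv :: "'v \<Rightarrow> 'v rpoly \<Rightarrow> 'v rpoly"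
  where "mpderiv i p = (\<Sum>a\<in>Poly_Mapping.keys p.
           Poly_Mapping.single (a - Poly_Mapping.single i 1)
             (of_nat (Poly_Mapping.lookup a i) * Poly_Mapping.lookup p a))"

definition dirderiv :: "real ^ 'v \<Rightarrow> 'v::finite rpoly \<Rightarrow> 'v rpoly"
  where "dirderiv v p = (\<Sum>k\<in>UNIV. mconst (v $ k) * mpderiv k p)"

definition only_real_zeros :: "real poly \<Rightarrow> bool"
  where "only_real_zeros p \<longleftrightarrow> (\<forall>z::complex. poly (map_poly of_real p) z = 0 \<longrightarrow> z \<in> \<real>)"

definition real_rooted :: "real poly \<Rightarrow> bool"
  where "real_rooted p \<longleftrightarrow> p = 0 \<or> only_real_zeros p"

definition hyperbolic :: "'n::finite rpoly \<Rightarrow> real ^ 'n \<Rightarrow> bool"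
  where "hyperbolic h e \<longleftrightarrow>
    (\<exists>d. homogeneous d h) \<and> meval h e \<noteq> 0 \<and> (\<forall>x. only_real_zeros (along h (- x) e))"

text \<open>
  The multiset $\{\lambda_1(x),\dots,\lambda_d(x)\}$: the roots, with multiplicity, of
  $h(te - x) = h(e)\prod_j (t - \lambda_j(x))$.
\<close>
definition eigenvalues :: "'n::finite rpoly \<Rightarrow> real ^ 'n \<Rightarrow> real ^ 'n \<Rightarrow> real multiset"
  where "eigenvalues h e x = proots (along h (- x) e)"

definition hyperbolicity_cone :: "'n::finite rpoly \<Rightarrow> real ^ 'n \<Rightarrow> (real ^ 'n) set"
  where "hyperbolicity_cone h e = {x. \<forall>l\<in>#eigenvalues h e x. l \<ge> 0}"

definition hrank :: "'n::finite rpoly \<Rightarrow> real ^ 'n \<Rightarrow> real ^ 'n \<Rightarrow> nat"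
  where "hrank h e x = size (filter_mset (\<lambda>l. l \<noteq> 0) (eigenvalues h e x))"

text \<open>The embeddings $\mathbb{R}^n \to \mathbb{R}^{n+m}$, $v \mapsto (v,0,\dots,0)$, and
  $\mathbb{R}[x_1,\dots,x_n] \subseteq \mathbb{R}[x_1,\dots,x_n,y_1,\dots,y_m]$.\<close>
definition pad :: "real ^ 'n::finite \<Rightarrow> real ^ ('n + 'm::finite)"
  where "pad v = (\<chi> i. case i of Inl k \<Rightarrow> v $ k | Inr _ \<Rightarrow> 0)"

definition lift_rpoly :: "'n rpoly \<Rightarrow> ('n + 'm) rpoly"
  where "lift_rpoly h = msubst mconst (\<lambda>k. mvar (Inl k)) h"

text \<open>The operator $1 - y_j D_v$ on $\mathbb{R}[x_1,\dots,x_n,y_1,\dots,y_m]$, for $v \in \mathbb{R}^n$.\<close>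
definition mixing_op :: "'m::finite \<Rightarrow> real ^ 'n::finite \<Rightarrow> ('n + 'm) rpoly \<Rightarrow> ('n + 'm) rpoly"
  where "mixing_op j v p = p - mvar (Inr j) * dirderiv (pad v) p"

text \<open>
  $h[v_1,\dots,v_m] = \prod_{j=1}^m (1 - y_j D_{v_j})\, h$, the product being composition of operators.
  The fold does not depend on an enumeration of the index type because the operators commute, which is
  proved below in \<open>comp_fun_commute_mixing_op\<close>.
\<close>
definition mixed :: "'n::finite rpoly \<Rightarrow> ('m::finite \<Rightarrow> real ^ 'n) \<Rightarrow> ('n + 'm) rpoly"
  where "mixed h v = Finite_Set.fold (\<lambda>j. mixing_op j (v j)) (lift_rpoly h) UNIV"

text \<open>
  The family is indexed by $S_1 \times \dots \times S_m$. The random variables live on an arbitrary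
  probability space over the type \<open>'w\<close>; a statement about all sample spaces is obtained by leaving
  \<open>'w\<close> free. Measurability into \<^term>\<open>count_space (S j)\<close> makes \<open>X j\<close> take its values in \<open>S j\<close>.
  The polynomial \<open>q\<close> is the expectation, which determines it uniquely.
\<close>
definition compatible_family ::
    "'w itself \<Rightarrow> ('m::finite \<Rightarrow> 'a set) \<Rightarrow> (('m \<Rightarrow> 'a) \<Rightarrow> real poly) \<Rightarrow> bool"
  where "compatible_family W S f \<longleftrightarrow>
    (\<forall>j. finite (S j)) \<and>
    (\<forall>s\<in>Pi UNIV S. \<forall>s'\<in>Pi UNIV S. f s \<noteq> 0 \<longrightarrow> f s' \<noteq> 0 \<longrightarrow>
       degree (f s) = degree (f s') \<and> sgn (lead_coeff (f s)) = sgn (lead_coeff (f s'))) \<and>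
    (\<forall>(M :: 'w measure) X. prob_space M \<longrightarrow>
       prob_space.indep_vars M (\<lambda>j. count_space (S j)) X UNIV \<longrightarrow>
       (\<exists>q. (\<forall>t. poly q t = (\<integral>\<omega>. poly (f (\<lambda>j. X j \<omega>)) t \<partial>M)) \<and> real_rooted q))"


section \<open>The operators commute\<close>

lemma mpderiv_superset:
  assumes "finite A" "Poly_Mapping.keys p \<subseteq> A"
  shows "mpderiv i p = (\<Sum>a\<in>A. Poly_Mapping.single (a - Poly_Mapping.single i 1)
             (of_nat (Poly_Mapping.lookup a i) * Poly_Mapping.lookup p a))"
  unfolding mpderiv_def
  by (rule sum.mono_neutral_left) (use assms in \<open>auto simp: in_keys_iff\<close>)

lemma mpderiv_add: "mpderiv i (p + q) = mpderiv i p + mpderiv i q"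
proof -
  let ?A = "Poly_Mapping.keys p \<union> Poly_Mapping.keys q"
  have "Poly_Mapping.keys (p + q) \<subseteq> ?A" by (rule Poly_Mapping.keys_add)
  then show ?thesis
    by (simp add: mpderiv_superset[of ?A] lookup_add distrib_left single_add sum.distrib)
qed

lemma mpderiv_0: "mpderiv i 0 = 0"
  by (simp add: mpderiv_def)

lemma mpderiv_sum: "mpderiv i (sum f A) = (\<Sum>x\<in>A. mpderiv i (f x))"
  by (induction A rule: infinite_finite_induct) (simp_all add: mpderiv_0 mpderiv_add)

lemma mpderiv_minus: "mpderiv i (- p) = - mpderiv i p"
  using mpderiv_add[of i p "- p"] by (simp add: mpderiv_0 eq_neg_iff_add_eq_0 add.commute)

lemma mpderiv_diff: "mpderiv i (p - q) = mpderiv i p - mpderiv i q"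
  using mpderiv_add[of i p "- q"] by (simp add: mpderiv_minus)

lemma mpderiv_single:
  "mpderiv i (Poly_Mapping.single a c) =
     Poly_Mapping.single (a - Poly_Mapping.single i 1) (of_nat (Poly_Mapping.lookup a i) * c)"
  by (subst mpderiv_superset[of "{a}"]) auto

lemma rpoly_induct [case_names zero single add]:
  fixes p :: "'v rpoly"
  assumes "P 0" "\<And>a c. P (Poly_Mapping.single a c)" "\<And>p q. P p \<Longrightarrow> P q \<Longrightarrow> P (p + q)"
  shows "P p"
proof (induction p rule: update_induct)
  case const
  show ?case by (rule assms(1))
next
  case (update f a b)
  have "Poly_Mapping.update a b f = f + Poly_Mapping.single a b"
    using update(1)
    by (intro poly_mapping_eqI)
       (auto simp: lookup_update lookup_add lookup_single when_def in_keys_iff)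
  then show ?case using update assms by simp
qed

lemma mpderiv_commute: "mpderiv i (mpderiv k p) = mpderiv k (mpderiv i p)"
proof (induction p rule: rpoly_induct)
  case (single a c)
  show ?case
    by (cases "i = k")
       (simp_all add: mpderiv_single lookup_minus lookup_single diff_diff_add add.commute mult_ac)
qed (simp_all add: mpderiv_0 mpderiv_add)

lemma mpderiv_mconst_mult: "mpderiv i (mconst c * p) = mconst c * mpderiv i p"
  by (induction p rule: rpoly_induct)
     (simp_all add: mpderiv_0 mpderiv_add mpderiv_single mconst_def mult_single distrib_left
        mult.left_commute)

lemma mpderiv_mvar_mult:
  assumes "i \<noteq> k"
  shows "mpderiv i (mvar k * p) = mvar k * mpderiv i p"
proof (induction p rule: rpoly_induct)
  case (single a c)
  have "Poly_Mapping.single k 1 + a - Poly_Mapping.single i 1 =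
        Poly_Mapping.single k 1 + (a - Poly_Mapping.single i (1::nat))"
    using assms by (intro poly_mapping_eqI) (auto simp: lookup_add lookup_minus lookup_single when_def)
  then show ?case
    using assms by (simp add: mpderiv_single mvar_def mult_single lookup_add lookup_single)
qed (simp_all add: mpderiv_0 mpderiv_add distrib_left)

lemma mconst_0: "mconst 0 = 0"
  by (simp add: mconst_def)

lemma dirderiv_diff: "dirderiv v (p - q) = dirderiv v p - dirderiv v q"
  by (simp add: dirderiv_def mpderiv_diff right_diff_distrib sum_subtractf)

lemma dirderiv_commute: "dirderiv u (dirderiv v p) = dirderiv v (dirderiv u p)"
proof -
  have *: "dirderiv u (dirderiv v p) =
      (\<Sum>k\<in>UNIV. \<Sum>l\<in>UNIV. mconst (u $ k) * (mconst (v $ l) * mpderiv k (mpderiv l p)))" for u v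
    by (simp add: dirderiv_def mpderiv_sum mpderiv_mconst_mult sum_distrib_left)
  show ?thesis
    unfolding *[of u v] *[of v u]
    by (subst sum.swap) (simp add: mpderiv_commute mult.left_commute)
qed

lemma dirderiv_pad_mvar:
  "dirderiv (pad v) (mvar (Inr j) * p) = mvar (Inr j) * dirderiv (pad v) p"
proof -
  have "mconst (pad v $ k) * mpderiv k (mvar (Inr j) * p) =
        mvar (Inr j) * (mconst (pad v $ k) * mpderiv k p)" for k
    by (cases k) (simp_all add: pad_def mconst_0 mpderiv_mvar_mult mult.left_commute)
  then show ?thesis
    by (simp add: dirderiv_def sum_distrib_left)
qed

lemma mixing_op_commute: "mixing_op i u (mixing_op j v p) = mixing_op j v (mixing_op i u p)"
  by (simp add: mixing_op_def dirderiv_diff dirderiv_pad_mvar dirderiv_commute[of "pad u" "pad v"]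
      algebra_simps)

lemma comp_fun_commute_mixing_op: "comp_fun_commute (\<lambda>j. mixing_op j (v j))"
  by unfold_locales (simp add: fun_eq_iff mixing_op_commute)

end

(* Call u admissible if h has no zero at w + i (s e + t u) for real w, s > 0 and t >= 0. Adding a vector
   of the hyperbolicity cone preserves admissibility: along a path of base points the zeros of a
   univariate polynomial of constant degree start in the lower half-plane and never meet the real axis.
   So h has no zeros over the tube R^n + i T, where T = { s e + u } with u admissible, and T absorbs
   convex combinations of cone vectors. If p has no zeros over the tube, then neither has (1 - y D_v) p
   for real y, because Im (D_v p / p) <= 0 there with equality only where D_v p = 0. Hence h[v_1,...,v_m]
   is real-rooted along e for all convex combinations v_j of cone vectors. As h[v_1,...,v_m] is affine in
   each v_j, the expectation over independent choices is the polynomial of the expected vectors.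

   A direction of rank k admits the bound |h(w + i r v)| <= 27^d |h(M e + r v)| = O(r^k), so h has degree
   at most k along it, and for k <= 1 the operator 1 - y D_v is the translation by -y v. *)

theory Submission
  imports Defs
begin

unbundle no fps_syntax

section \<open>Evaluation and restriction to lines\<close>

text \<open>Values in any real normed field, so that the same rules serve \<open>meval\<close> and
  the complex points at which zeros have to be excluded.\<close>

definition ev :: "('v \<Rightarrow> 'b::real_normed_field) \<Rightarrow> 'v rpoly \<Rightarrow> 'b"
  where "ev x p = msubst of_real x p"

definition line :: "('v \<Rightarrow> 'b::real_normed_field) \<Rightarrow> ('v \<Rightarrow> 'b) \<Rightarrow> 'v rpoly \<Rightarrow> 'b poly"
  where "line a b p = msubst (\<lambda>r. [:of_real r:]) (\<lambda>i. [:a i, b i:]) p"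

lemma meval_eq_ev: "meval p x = ev (\<lambda>i. x $ i) p"
  by (simp add: meval_def ev_def id_def)

lemma along_eq_line: "along p a b = line (\<lambda>i. a $ i) (\<lambda>i. b $ i) p"
  by (simp add: along_def line_def)

lemma msubst_add:
  assumes "c 0 = 0" "\<And>a b. c (a + b) = c a + c b"
  shows "msubst c \<phi> (p + q) = msubst c \<phi> p + msubst c \<phi> q"
proof -
  let ?A = "Poly_Mapping.keys p \<union> Poly_Mapping.keys q"
  have *: "msubst c \<phi> r = (\<Sum>a\<in>?A. c (Poly_Mapping.lookup r a) *
      (\<Prod>i\<in>Poly_Mapping.keys a. \<phi> i ^ Poly_Mapping.lookup a i))"
    if "Poly_Mapping.keys r \<subseteq> ?A" for r
    unfolding msubst_def using that assms(1)
    by (intro sum.mono_neutral_left) (auto simp: in_keys_iff)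
  show ?thesis
    using Poly_Mapping.keys_add[of p q]
    by (simp add: * lookup_add assms(2) distrib_right sum.distrib)
qed

lemma msubst_single:
  fixes \<phi> :: "'v::finite \<Rightarrow> 'b::comm_ring_1"
  assumes "c 0 = 0"
  shows "msubst c \<phi> (Poly_Mapping.single a r) =
    c r * (\<Prod>i\<in>UNIV. \<phi> i ^ Poly_Mapping.lookup a i)"
proof -
  have "(\<Prod>i\<in>Poly_Mapping.keys a. \<phi> i ^ Poly_Mapping.lookup a i) =
      (\<Prod>i\<in>UNIV. \<phi> i ^ Poly_Mapping.lookup a i)"
    by (intro prod.mono_neutral_left) (auto simp: in_keys_iff)
  then show ?thesis
    using assms by (simp add: msubst_def)
qed

lemma poly_line: "poly (line a b p) z = ev (\<lambda>i. a i + z * b i) p"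
  by (simp add: line_def ev_def msubst_def poly_sum poly_prod)

lemma of_real_ev: "of_real (ev x p) = ev (\<lambda>i. of_real (x i)) p"
  for x :: "'v \<Rightarrow> real"
  by (simp add: ev_def msubst_def)

lemma cnj_ev: "cnj (ev x p) = ev (\<lambda>i. cnj (x i)) p"
  by (simp add: ev_def msubst_def)

lemma of_real_meval: "of_real (meval p x) = ev (\<lambda>i. of_real (x $ i)) p"
  by (simp add: meval_eq_ev of_real_ev)

lemma poly_along: "poly (along p a b) t = meval p (a + t *\<^sub>R b)"
  by (simp add: along_eq_line poly_line meval_eq_ev)

text \<open>Turns the complex zeros in \<open>only_real_zeros\<close> into zeros of the multivariate
  polynomial at complex points \<open>a + z b\<close>.\<close>

lemma map_poly_along:
  "map_poly of_real (along p a b) =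
    (line (\<lambda>i. of_real (a $ i)) (\<lambda>i. of_real (b $ i)) p :: complex poly)"
proof -
  have hom: "map_poly of_real (q * r) = (map_poly of_real q * map_poly of_real r :: complex poly)"
    for q r :: "real poly"
    by (rule poly_eqI) (simp add: coeff_map_poly coeff_mult)
  have one: "map_poly of_real 1 = (1 :: complex poly)" by (rule poly_eqI) (simp add: coeff_map_poly)
  have pow: "map_poly of_real (q ^ k) = (map_poly of_real q ^ k :: complex poly)"
    for q :: "real poly" and k
    by (induction k) (simp_all add: hom one)
  have prd: "map_poly of_real (\<Prod>i\<in>A. f i) = (\<Prod>i\<in>A. map_poly of_real (f i) :: complex poly)"
    for f :: "_ \<Rightarrow> real poly" and A
    by (induction A rule: infinite_finite_induct) (simp_all add: hom one)
  have sm: "map_poly of_real (\<Sum>i\<in>A. f i) = (\<Sum>i\<in>A. map_poly of_real (f i) :: complex poly)"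
    for f :: "_ \<Rightarrow> real poly" and A
    by (rule poly_eqI) (simp add: coeff_map_poly coeff_sum)
  have smul: "map_poly of_real (smult c q) = (smult (of_real c) (map_poly of_real q) :: complex poly)"
    for c and q :: "real poly"
    by (rule poly_eqI) (simp add: coeff_map_poly)
  show ?thesis
    by (simp add: along_def line_def msubst_def sm smul prd pow map_poly_pCons)
qed

lemma ev_add: "ev x (p + q) = ev x p + ev x q"
  by (simp add: ev_def msubst_add)

lemma ev_0: "ev x 0 = 0"
  by (simp add: ev_def msubst_def)

lemma ev_diff: "ev x (p - q) = ev x p - ev x q"
  using ev_add[of x "p - q" q] by simp

lemma ev_sum: "ev x (\<Sum>i\<in>A. f i) = (\<Sum>i\<in>A. ev x (f i))"
  by (induction A rule: infinite_finite_induct) (simp_all add: ev_0 ev_add)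

lemma ev_single:
  "ev x (Poly_Mapping.single a r) =
    of_real r * (\<Prod>i\<in>UNIV. x i ^ Poly_Mapping.lookup a i)"
  for x :: "'v::finite \<Rightarrow> 'b::real_normed_field"
  by (simp add: ev_def msubst_single)

lemma ev_mult: "ev x (p * q) = ev x p * ev x q"
  for x :: "'v::finite \<Rightarrow> 'b::real_normed_field"
proof (induction p rule: rpoly_induct)
  case (single a r)
  show ?case
    by (induction q rule: rpoly_induct)
       (simp_all add: ev_0 mult_single ev_single ev_add distrib_left lookup_add power_add
         prod.distrib algebra_simps)
qed (simp_all add: ev_0 ev_add distrib_right)

lemma ev_mconst: "ev x (mconst r) = of_real r"
  for x :: "'v::finite \<Rightarrow> 'b::real_normed_field"
  by (simp add: mconst_def ev_single)

lemma ev_mvar: "ev x (mvar k) = x k"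
  for x :: "'v::finite \<Rightarrow> 'b::real_normed_field"
proof -
  have "(\<Prod>i\<in>UNIV. x i ^ Poly_Mapping.lookup (Poly_Mapping.single k (1::nat)) i) =
      (\<Prod>i\<in>{k}. x i ^ Poly_Mapping.lookup (Poly_Mapping.single k (1::nat)) i)"
    by (intro prod.mono_neutral_right) (auto simp: lookup_single)
  then show ?thesis
    by (simp add: mvar_def ev_single)
qed

lemma ev_power: "ev x (p ^ k) = ev x p ^ k"
  for x :: "'v::finite \<Rightarrow> 'b::real_normed_field"
  by (induction k) (simp_all add: ev_mult flip: mconst_def, simp add: ev_mconst[of x 1, unfolded mconst_def, simplified])

lemma ev_prod: "ev x (\<Prod>i\<in>A. f i) = (\<Prod>i\<in>A. ev x (f i))"
  for x :: "'v::finite \<Rightarrow> 'b::real_normed_field"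
  using ev_mconst[of x 1]
  by (induction A rule: infinite_finite_induct) (simp_all add: ev_mult mconst_def)

lemma ev_lift_rpoly: "ev x (lift_rpoly h) = ev (\<lambda>k. x (Inl k)) h"
  for x :: "'n::finite + 'm::finite \<Rightarrow> 'b::real_normed_field"
  unfolding lift_rpoly_def msubst_def ev_sum ev_mult ev_prod ev_power ev_mconst ev_mvar
  by (simp add: ev_def msubst_def)

lemma line_add: "line a b (p + q) = line a b p + line a b q"
  by (simp add: line_def msubst_add)

lemma line_single:
  "line a b (Poly_Mapping.single k r) =
    smult (of_real r) (\<Prod>i\<in>UNIV. [:a i, b i:] ^ Poly_Mapping.lookup k i)"
  for a :: "'v::finite \<Rightarrow> 'b::real_normed_field"
  by (simp add: line_def msubst_single)

text \<open>Both sides are additive in \<open>p\<close>, so monomials suffice, where this is the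
  product rule. It lets the univariate estimates speak about the formal
  \<open>dirderiv\<close>.\<close>

lemma poly_pderiv_line:
  fixes x :: "'v::finite \<Rightarrow> 'b::real_normed_field"
  shows "poly (pderiv (line x (\<lambda>i. of_real (v $ i)) p)) 0 = ev x (dirderiv v p)"
proof (induction p rule: rpoly_induct)
  case zero
  then show ?case by (simp add: line_def msubst_def ev_def dirderiv_def mpderiv_0)
next
  case (add p q)
  have "dirderiv v (p + q) = dirderiv v p + dirderiv v q"
    by (simp add: dirderiv_def mpderiv_add distrib_left sum.distrib)
  with add show ?case by (simp add: line_add pderiv_add ev_add)
next
  case (single a r)
  \<comment> \<open>If the exponent of \<open>k\<close> is zero, both truncated subtractions leave
    it zero; both sides of the next identity then vanish.\<close>
  have *: "(\<Prod>i\<in>UNIV. x i ^ Poly_Mapping.lookup (a - Poly_Mapping.single k 1) i) =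
      x k ^ (Poly_Mapping.lookup a k - 1) * (\<Prod>i\<in>UNIV - {k}. x i ^ Poly_Mapping.lookup a i)" for k
    by (subst prod.remove[of _ k])
       (auto simp: lookup_minus lookup_single when_def intro!: prod.cong)
  have **: "poly (pderiv ([:x k, of_real (v $ k):] ^ Poly_Mapping.lookup a k)) 0 =
      of_real (v $ k) * (of_nat (Poly_Mapping.lookup a k) * x k ^ (Poly_Mapping.lookup a k - 1))" for k
    by (cases "Poly_Mapping.lookup a k") (simp_all add: pderiv_power_Suc pderiv_pCons poly_power mult_ac del: power_Suc)
  have "ev x (dirderiv v (Poly_Mapping.single a r)) = (\<Sum>k\<in>UNIV. of_real (v $ k) *
      (of_nat (Poly_Mapping.lookup a k) * of_real r *
        (x k ^ (Poly_Mapping.lookup a k - 1) * (\<Prod>i\<in>UNIV - {k}. x i ^ Poly_Mapping.lookup a i))))"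
    using * by (simp add: dirderiv_def mpderiv_single ev_sum ev_mult ev_mconst ev_single)
  also have "\<dots> = poly (pderiv (line x (\<lambda>i. of_real (v $ i)) (Poly_Mapping.single a r))) 0"
    using ** by (simp add: line_single pderiv_smult pderiv_prod poly_sum poly_prod sum_distrib_left mult_ac)
  finally show ?case by simp
qed

lemma dirderiv_lincomb:
  "dirderiv (\<Sum>s\<in>A. c s *\<^sub>R u s) p = (\<Sum>s\<in>A. mconst (c s) * dirderiv (u s) p)"
proof -
  have "(mconst (\<Sum>s\<in>A. c s * u s $ k) :: 'a rpoly) = (\<Sum>s\<in>A. mconst (c s) * mconst (u s $ k))" for k
    by (induction A rule: infinite_finite_induct) (simp_all add: mconst_def single_add mult_single)
  then have "dirderiv (\<Sum>s\<in>A. c s *\<^sub>R u s) p =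
      (\<Sum>k\<in>UNIV. \<Sum>s\<in>A. mconst (c s) * (mconst (u s $ k) * mpderiv k p))"
    by (simp add: dirderiv_def sum_distrib_right mult.assoc)
  also have "\<dots> = (\<Sum>s\<in>A. mconst (c s) * dirderiv (u s) p)"
    by (subst sum.swap) (simp add: dirderiv_def sum_distrib_left)
  finally show ?thesis .
qed

lemma ev_mixing_op:
  "ev x (mixing_op j v p) = ev x p - x (Inr j) * ev x (dirderiv (pad v) p)"
  for x :: "'n::finite + 'm::finite \<Rightarrow> 'b::real_normed_field"
  by (simp add: mixing_op_def ev_diff ev_mult ev_mvar)

section \<open>Functional homogeneity\<close>

text \<open>Homogeneity as an identity of functions: in this form it passes through
  \<open>mixing_op\<close> by differentiation, without tracking exponent vectors.\<close>

definition fhom :: "nat \<Rightarrow> 'v::finite rpoly \<Rightarrow> bool"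
  where "fhom d p \<longleftrightarrow> (\<forall>c x. c \<noteq> 0 \<longrightarrow> ev (\<lambda>i. c * x i) p = c ^ d * (ev x p :: complex))"

lemma fhom_homogeneous:
  assumes "homogeneous d p"
  shows "fhom d p"
  unfolding fhom_def
proof (intro allI impI)
  fix c :: complex and x :: "'a \<Rightarrow> complex"
  have "(\<Prod>i\<in>Poly_Mapping.keys a. (c * x i) ^ Poly_Mapping.lookup a i) =
      c ^ d * (\<Prod>i\<in>Poly_Mapping.keys a. x i ^ Poly_Mapping.lookup a i)"
    if "a \<in> Poly_Mapping.keys p" for a
    using assms that by (simp add: homogeneous_def power_mult_distrib prod.distrib flip: power_sum)
  then show "ev (\<lambda>i. c * x i) p = c ^ d * ev x p"
    by (simp add: ev_def msubst_def sum_distrib_left mult.left_commute)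
qed

text \<open>Pulling \<open>z\<close> out of \<open>a + z b\<close> leaves \<open>b + a / z\<close>:
  exchanging base point and direction reverses the coefficients within degree
  \<open>d\<close>.\<close>

lemma fhom_line:
  fixes a b :: "'v::finite \<Rightarrow> complex"
  assumes "fhom d p" "z \<noteq> 0"
  shows "poly (line a b p) z = z ^ d * poly (line b a p) (inverse z)"
proof -
  have "(\<lambda>i. a i + z * b i) = (\<lambda>i. z * (b i + inverse z * a i))"
    using assms(2) by (auto simp: field_simps)
  then show ?thesis
    using assms by (simp add: poly_line fhom_def)
qed

text \<open>If \<open>degree Q\<close> exceeded \<open>d\<close>, then
  \<open>z ^ (degree Q - d) * P\<close> would be the reflected \<open>Q\<close>, whose value at 0 is
  the nonzero leading coefficient of \<open>Q\<close>, while the product vanishes there. Hence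
  \<open>P\<close> is the reflected \<open>Q\<close> times a power of \<open>z\<close>.\<close>

lemma poly_reversal:
  fixes P Q :: "'a::{field_char_0} poly"
  assumes "\<And>z. z \<noteq> 0 \<Longrightarrow> poly P z = z ^ d * poly Q (inverse z)"
  shows "degree P \<le> d" "coeff P d = coeff Q 0"
proof -
  have r: "poly (reflect_poly Q) z = z ^ degree Q * poly Q (inverse z)" if "z \<noteq> 0" for z
    using that by (rule poly_reflect_poly_nz)
  have inf: "infinite (- {0 :: 'a})"
    by (simp add: infinite_UNIV_char_0 Compl_eq_Diff_UNIV)
  have eqI: "A = B" if "\<And>z. z \<noteq> 0 \<Longrightarrow> poly A z = poly B z" for A B :: "'a poly"
  proof (rule ccontr)
    assume "A \<noteq> B"
    then have "finite {z. poly (A - B) z = 0}" using poly_roots_finite[of "A - B"] by simp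
    moreover have "- {0} \<subseteq> {z. poly (A - B) z = 0}" using that by auto
    ultimately show False using inf finite_subset by blast
  qed
  have le: "degree Q \<le> d"
  proof (rule ccontr)
    assume less: "\<not> degree Q \<le> d"
    then have "Q \<noteq> 0" by auto
    have "monom 1 (degree Q - d) * P = reflect_poly Q"
      using assms less
      by (intro eqI) (simp add: r poly_monom flip: power_add mult.assoc)
    then have "coeff (monom 1 (degree Q - d) * P) 0 = lead_coeff Q" by simp
    then show False using less \<open>Q \<noteq> 0\<close> by (simp add: coeff_monom_mult)
  qed
  have P: "P = monom 1 (d - degree Q) * reflect_poly Q"
    using assms le
    by (intro eqI) (simp add: r poly_monom flip: power_add mult.assoc)
  show "degree P \<le> d"
    unfolding P using le degree_mult_le[of "monom 1 (d - degree Q)" "reflect_poly Q"]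
      degree_reflect_poly_le[of Q] degree_monom_le[of "1::'a" "d - degree Q"] by linarith
  show "coeff P d = coeff Q 0"
    unfolding P using le by (simp add: coeff_monom_mult coeff_reflect_poly)
qed

text \<open>The coefficient of degree \<open>d\<close> depends on the direction alone. Where it is
  nonzero, the degree stays constant as the base point moves.\<close>

lemma fhom_line_degree: "degree (line a b p) \<le> d" and fhom_line_coeff: "coeff (line a b p) d = ev b p"
  if "fhom d p" for a b :: "'v::finite \<Rightarrow> complex"
  using poly_reversal[OF fhom_line[OF that, of _ a b]] poly_line[of b a p 0]
  by (simp_all add: poly_0_coeff_0)

text \<open>Differentiating \<open>p (c x + c z v) = c ^ d p (x + z v)\<close> at
  \<open>z = 0\<close> shows that the derivative scales with one power of \<open>c\<close> less; the
  factor \<open>y_j\<close> restores it.\<close>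

lemma fhom_mixing_op:
  assumes "fhom d p"
  shows "fhom d (mixing_op j v p)"
  unfolding fhom_def
proof (intro allI impI)
  fix c :: complex and x :: "_ \<Rightarrow> complex"
  assume c: "c \<noteq> 0"
  let ?L = "\<lambda>x. line x (\<lambda>i. of_real (pad v $ i)) p"
  have "c * (poly (?L (\<lambda>i. c * x i)) (c * z)) = c * (c ^ d * poly (?L x) z)" for z
  proof -
    have "(\<lambda>i. c * x i + c * z * of_real (pad v $ i)) = (\<lambda>i. c * (x i + z * of_real (pad v $ i)))"
      by (simp add: algebra_simps)
    then show ?thesis using assms c by (simp add: poly_line fhom_def)
  qed
  then have "pcompose (?L (\<lambda>i. c * x i)) [:0, c:] = smult (c ^ d) (?L x)"
    using c by (intro poly_eqI_degree poly_eq_poly_eq_iff[THEN iffD1] ext) (simp add: poly_pcompose mult.commute)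
  then have "poly (pderiv (pcompose (?L (\<lambda>i. c * x i)) [:0, c:])) 0 =
      poly (pderiv (smult (c ^ d) (?L x))) 0" by simp
  then have "c * ev (\<lambda>i. c * x i) (dirderiv (pad v) p) = c ^ d * ev x (dirderiv (pad v) p)"
    by (simp add: pderiv_pcompose poly_pcompose pderiv_smult pderiv_pCons poly_pderiv_line mult.commute)
  then show "ev (\<lambda>i. c * x i) (mixing_op j v p) = c ^ d * ev x (mixing_op j v p)"
    using assms c by (simp add: ev_mixing_op fhom_def algebra_simps)
qed

section \<open>Univariate polynomials without zeros in the closed upper half-plane\<close>

text \<open>A nonconstant \<open>P\<close> has a complex root, necessarily below the real axis, and
  the cofactor inherits the hypothesis. The estimates that follow are thus checked one linear factor
  at a time.\<close>

lemma lower_roots_induct [consumes 1, case_names const factor]: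
  fixes P :: "complex poly"
  assumes "\<forall>z. Im z \<ge> 0 \<longrightarrow> poly P z \<noteq> 0"
    and "\<And>c. c \<noteq> 0 \<Longrightarrow> Q [:c:]"
    and "\<And>r P. Im r < 0 \<Longrightarrow> P \<noteq> 0 \<Longrightarrow> (\<And>z. Im z \<ge> 0 \<Longrightarrow> poly P z \<noteq> 0) \<Longrightarrow> Q P \<Longrightarrow> Q ([:- r, 1:] * P)"
  shows "Q P"
  using assms(1)
proof (induction "degree P" arbitrary: P)
  case 0
  then obtain c where "P = [:c:]" by (metis degree_eq_zeroE)
  moreover from this 0(2) have "c \<noteq> 0" using 0(2)[rule_format, of 0] by auto
  ultimately show ?case using assms(2) by simp
next
  case (Suc n)
  then have "\<not> constant (poly P)" by (metis constant_degree nat.distinct(1))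
  then obtain r where "poly P r = 0" using fundamental_theorem_of_algebra by blast
  then obtain R where R: "P = [:- r, 1:] * R" by (metis dvdE poly_eq_0_iff_dvd)
  have "Im r < 0" using Suc.prems \<open>poly P r = 0\<close> by (metis not_le)
  moreover have "R \<noteq> 0" using Suc(2) R by auto
  moreover have nz: "poly R z \<noteq> 0" if "Im z \<ge> 0" for z using Suc.prems that R by auto
  moreover have "Suc (degree R) = degree P"
    unfolding R using \<open>R \<noteq> 0\<close> by (subst degree_mult_eq) auto
  with Suc(1)[of R] Suc(2) nz have "Q R" by simp
  ultimately show ?case unfolding R by (intro assms(3))
qed

text \<open>Every root \<open>r\<close> lies below the real axis, so each factor
  \<open>z - r\<close> has modulus at least \<open>Im z\<close>.\<close>

lemma lower_roots_norm_ge: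
  fixes P :: "complex poly"
  assumes "\<And>z. Im z \<ge> 0 \<Longrightarrow> poly P z \<noteq> 0" "Im z \<ge> 0"
  shows "norm (lead_coeff P) * Im z ^ degree P \<le> norm (poly P z)"
proof -
  have "\<forall>z. Im z \<ge> 0 \<longrightarrow> poly P z \<noteq> 0" using assms(1) by blast
  then show ?thesis
  proof (induction rule: lower_roots_induct)
    case (factor r P)
    have deg: "degree ([:- r, 1:] * P) = Suc (degree P)"
      using factor by (subst degree_mult_eq) auto
    have "Im z \<le> Im (z - r)" using factor by simp
    also have "\<dots> \<le> norm (z - r)" using abs_Im_le_cmod[of "z - r"] by linarith
    finally have "norm (lead_coeff P) * Im z ^ degree P * Im z \<le> norm (poly P z) * norm (z - r)"
      using factor assms(2) by (intro mult_mono) auto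
    moreover have "poly ([:- r, 1:] * P) z = poly P z * (z - r)" by (simp add: algebra_simps)
    moreover have "lead_coeff ([:- r, 1:] * P) = lead_coeff P" unfolding lead_coeff_mult by simp
    ultimately show ?case
      unfolding deg by (simp only: norm_mult power_Suc2 mult.assoc)
  qed simp
qed

text \<open>Each root \<open>r\<close> has \<open>|i - r| >= 1\<close>, hence
  \<open>|z - r| <= |z - i| + |i - r| <= 2 + |i - r| <= 3 |i - r|\<close>.\<close>

lemma lower_roots_norm_le:
  fixes P :: "complex poly"
  assumes "\<And>z. Im z \<ge> 0 \<Longrightarrow> poly P z \<noteq> 0" "norm z \<le> 1"
  shows "norm (poly P z) \<le> 3 ^ degree P * norm (poly P \<i>)"
proof -
  have "\<forall>z. Im z \<ge> 0 \<longrightarrow> poly P z \<noteq> 0" using assms(1) by blast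
  then show ?thesis
  proof (induction rule: lower_roots_induct)
    case (factor r P)
    have deg: "degree ([:- r, 1:] * P) = Suc (degree P)"
      using factor by (subst degree_mult_eq) auto
    have "1 \<le> Im (\<i> - r)" using factor by simp
    also have "\<dots> \<le> norm (\<i> - r)" using abs_Im_le_cmod[of "\<i> - r"] by linarith
    finally have "1 \<le> norm (\<i> - r)" .
    moreover have "norm (z - r) \<le> norm z + norm \<i> + norm (\<i> - r)"
      using norm_triangle_ineq[of "z - \<i>" "\<i> - r"] norm_triangle_ineq4[of z \<i>] by simp
    ultimately have "norm (z - r) \<le> 3 * norm (\<i> - r)" using assms(2) by simp
    then have "norm (z - r) * norm (poly P z) \<le> 3 * norm (\<i> - r) * (3 ^ degree P * norm (poly P \<i>))"
      using factor by (intro mult_mono) auto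
    moreover have "poly ([:- r, 1:] * P) w = (w - r) * poly P w" for w by (simp add: algebra_simps)
    ultimately show ?case
      unfolding deg by (simp only: norm_mult power_Suc mult_ac)
  qed simp
qed

text \<open>The quotient is the sum of \<open>- 1 / r\<close> over the roots, and each term has
  negative imaginary part. The first alternative covers the constant polynomials.\<close>

lemma lower_roots_log_deriv:
  fixes P :: "complex poly"
  assumes "\<And>z. Im z \<ge> 0 \<Longrightarrow> poly P z \<noteq> 0"
  shows "poly (pderiv P) 0 = 0 \<or> Im (poly (pderiv P) 0 / poly P 0) < 0"
proof -
  have "\<forall>z. Im z \<ge> 0 \<longrightarrow> poly P z \<noteq> 0" using assms(1) by blast
  then show ?thesis
  proof (induction rule: lower_roots_induct)
    case (factor r P)
    have "poly P 0 \<noteq> 0" "r \<noteq> 0" using factor by auto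
    moreover have "pderiv ([:- r, 1:] * P) = [:- r, 1:] * pderiv P + P"
      unfolding pderiv_mult by (simp add: pderiv_pCons)
    ultimately have "poly (pderiv ([:- r, 1:] * P)) 0 / poly ([:- r, 1:] * P) 0 =
        poly (pderiv P) 0 / poly P 0 + - inverse r"
      by (simp only:) (simp add: field_simps)
    moreover have "Im (- inverse r) < 0"
      using factor \<open>r \<noteq> 0\<close> by (simp add: divide_neg_pos sum_power2_gt_zero_iff complex_eq_iff)
    ultimately show ?case using factor by auto
  qed simp
qed

text \<open>A zero would make the logarithmic derivative at 0 equal to the real number
  \<open>1 / y\<close>.\<close>

lemma lower_roots_shift_deriv:
  fixes P :: "complex poly"
  assumes "\<And>z. Im z \<ge> 0 \<Longrightarrow> poly P z \<noteq> 0"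
  shows "poly P 0 - of_real y * poly (pderiv P) 0 \<noteq> 0"
proof
  assume "poly P 0 - of_real y * poly (pderiv P) 0 = 0"
  then have eq: "poly P 0 = of_real y * poly (pderiv P) 0" by simp
  have "poly P 0 \<noteq> 0" by (rule assms) simp
  then have "y \<noteq> 0" "poly (pderiv P) 0 \<noteq> 0" unfolding eq by simp_all
  then have "poly (pderiv P) 0 / poly P 0 = of_real (inverse y)"
    unfolding eq by (simp add: field_simps)
  then have "Im (poly (pderiv P) 0 / poly P 0) = 0" by (simp only: Im_complex_of_real)
  moreover have "poly (pderiv P) 0 = 0 \<or> Im (poly (pderiv P) 0 / poly P 0) < 0"
    by (rule lower_roots_log_deriv) (rule assms)
  ultimately show False using \<open>poly (pderiv P) 0 \<noteq> 0\<close> by (metis less_irrefl)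
qed

text \<open>Subtracting the constant coefficient and dividing by \<open>z\<close> lowers
  \<open>k\<close> by one. For \<open>k = 0\<close> a nonconstant polynomial would tend to infinity
  along the imaginary ray.\<close>

lemma degree_le_of_growth:
  fixes P :: "complex poly"
  assumes "\<And>r. r \<ge> 1 \<Longrightarrow> norm (poly P (\<i> * of_real r)) \<le> C * r ^ k"
  shows "degree P \<le> k"
  using assms
proof (induction k arbitrary: P C)
  case 0
  show ?case
  proof (rule ccontr)
    assume "\<not> degree P \<le> 0"
    then have "degree P > 0" by simp
    then have lim: "filterlim (poly P) at_infinity at_infinity" by (rule filterlim_poly_at_infinity)
    have "filterlim (\<lambda>r. \<i> * of_real r :: complex) at_infinity at_top"
      by (rule filterlim_norm_at_top_imp_at_infinity) (simp add: norm_mult filterlim_abs_real)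
    with lim have "filterlim (\<lambda>r. poly P (\<i> * of_real r)) at_infinity at_top"
      by (rule filterlim_compose)
    then have "filterlim (\<lambda>r. norm (poly P (\<i> * of_real r))) at_top at_top"
      by (rule filterlim_at_infinity_imp_norm_at_top)
    then have "eventually (\<lambda>r. norm (poly P (\<i> * of_real r)) \<ge> \<bar>C\<bar> + 1) at_top"
      by (simp only: filterlim_at_top)
    then have "eventually (\<lambda>r::real. False) at_top"
      using eventually_ge_at_top[of 1]
    proof eventually_elim
      case (elim r)
      then show ?case using 0[of r] by simp
    qed
    then show False by simp
  qed
next
  case (Suc k)
  obtain a Q where P: "P = pCons a Q" by (cases P)
  have "norm (poly Q (\<i> * of_real r)) \<le> (C + norm a) * r ^ k" if r: "r \<ge> 1" for r
  proof -
    have "r * norm (poly Q (\<i> * of_real r)) = norm (poly P (\<i> * of_real r) - a)"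
      using r by (simp add: P norm_mult)
    also have "\<dots> \<le> C * r ^ Suc k + norm a * r ^ Suc k"
      using Suc.prems[OF r] norm_triangle_ineq4[of "poly P (\<i> * of_real r)" a]
        mult_left_mono[OF one_le_power[OF r, of "Suc k"], of "norm a"] by simp
    also have "\<dots> = r * ((C + norm a) * r ^ k)" by (simp add: algebra_simps)
    finally show ?thesis using r by simp
  qed
  then have "degree Q \<le> k" by (rule Suc.IH)
  then show ?case using degree_pCons_le[of a Q] by (simp add: P)
qed

lemma poly_map_poly_of_real: "poly (map_poly of_real p) (of_real r) = (of_real (poly p r) :: complex)"
  by (induction p) (simp_all add: map_poly_pCons)

text \<open>\<open>proots\<close> counts real roots only. A root exists over the complex numbers, is
  real by hypothesis, and splits off over the reals.\<close>

lemma size_proots_only_real_zeros: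
  assumes "only_real_zeros p" "p \<noteq> 0"
  shows "size (proots p) = degree p"
  using assms
proof (induction "degree p" arbitrary: p)
  case 0
  then obtain c where "p = [:c:]" using degree_eq_zeroE[of p] by metis
  then show ?case by simp
next
  case (Suc n)
  have "degree (map_poly of_real p :: complex poly) = degree p" by (simp add: degree_map_poly)
  with Suc(2) have "\<not> constant (poly (map_poly of_real p :: complex poly))"
    unfolding constant_degree by linarith
  then obtain z :: complex where z: "poly (map_poly of_real p) z = 0"
    using fundamental_theorem_of_algebra by blast
  then have "z \<in> \<real>" using Suc.prems(1) unfolding only_real_zeros_def by blast
  then obtain r where "z = of_real r" by (elim Reals_cases)
  with z have "poly p r = 0" by (simp add: poly_map_poly_of_real)
  then obtain q where q: "p = [:- r, 1:] * q" by (metis dvdE poly_eq_0_iff_dvd)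
  have "q \<noteq> 0" using Suc.prems(2) q by (metis mult_zero_right)
  have map: "map_poly of_real p = [:- of_real r, 1:] * (map_poly of_real q :: complex poly)"
    unfolding q by (rule poly_eqI) (simp add: coeff_map_poly coeff_pCons split: nat.split)
  have "only_real_zeros q"
    unfolding only_real_zeros_def
  proof (intro allI impI)
    fix w :: complex
    assume "poly (map_poly of_real q) w = 0"
    then have "poly (map_poly of_real p) w = 0"
      unfolding map poly_mult by (metis mult_zero_right)
    then show "w \<in> \<real>" using Suc.prems(1) unfolding only_real_zeros_def by blast
  qed
  moreover have deg: "degree p = Suc (degree q)"
    unfolding q using \<open>q \<noteq> 0\<close> by (subst degree_mult_eq) auto
  ultimately have "size (proots q) = degree q" using Suc(1)[of q] Suc(2) \<open>q \<noteq> 0\<close> by linarith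
  moreover have "proots p = {#r#} + proots q"
    unfolding q using \<open>q \<noteq> 0\<close> by (subst proots_mult) auto
  ultimately show ?case using deg by (metis size_union size_single plus_1_eq_Suc)
qed

section \<open>Hyperbolicity directions\<close>

text \<open>Zeros of \<open>z \<mapsto> p (a + \<tau> b + z v)\<close> that start below the real axis and never meet it stay below
  it. The bound \<open>lower_roots_norm_ge\<close> makes this condition on \<open>\<tau>\<close> closed, and compactness
  makes its negation closed as well.\<close>

lemma zeros_stay_below:
  fixes a b v :: "'v::finite \<Rightarrow> complex"
  assumes hom: "fhom d p" and v: "ev v p \<noteq> 0"
    and start: "\<And>z. Im z \<ge> 0 \<Longrightarrow> ev (\<lambda>i. a i + z * v i) p \<noteq> 0"
    and avoid: "\<And>\<tau> z. 0 \<le> \<tau> \<Longrightarrow> \<tau> \<le> 1 \<Longrightarrow> z \<in> \<real> \<Longrightarrow> ev (\<lambda>i. a i + of_real \<tau> * b i + z * v i) p \<noteq> 0"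
    and "Im z \<ge> 0"
  shows "ev (\<lambda>i. a i + b i + z * v i) p \<noteq> 0"
proof -
  define F where "F \<tau> z = ev (\<lambda>i. a i + of_real \<tau> * b i + z * v i) p" for \<tau> z
  define P where "P \<tau> = line (\<lambda>i. a i + of_real \<tau> * b i) v p" for \<tau>
  have F_P: "F \<tau> z = poly (P \<tau>) z" for \<tau> z by (simp add: F_def P_def poly_line)
  have deg: "degree (P \<tau>) = d" and lead: "lead_coeff (P \<tau>) = ev v p" for \<tau>
  proof -
    have *: "degree (P \<tau>) \<le> d" "coeff (P \<tau>) d = ev v p"
      unfolding P_def using hom by (rule fhom_line_degree, rule fhom_line_coeff)
    with v show "degree (P \<tau>) = d" by (metis le_antisym le_degree)
    with * show "lead_coeff (P \<tau>) = ev v p" by simp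
  qed
  have contF: "continuous_on UNIV (\<lambda>(\<tau>, z). F \<tau> z)"
    unfolding F_def ev_def msubst_def case_prod_unfold by (intro continuous_intros)
  \<comment> \<open>\<open>G\<close> is the reversed polynomial in \<open>s = 1 / z\<close>. At
    \<open>s = 0\<close> it equals the nonzero \<open>ev v p\<close> for every
    \<open>\<tau>\<close>, so uniform continuity keeps it nonzero for small \<open>s\<close>; this
    bounds the zeros of \<open>F \<tau>\<close> uniformly in \<open>\<tau>\<close>.\<close>
  define G where "G \<tau> s = ev (\<lambda>i. v i + s * (a i + of_real \<tau> * b i)) p" for \<tau> s
  have contG: "continuous_on ({0..1} \<times> cball 0 1) (\<lambda>(\<tau>, s). G \<tau> s)"
    unfolding G_def ev_def msubst_def case_prod_unfold by (intro continuous_intros)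
  have "uniformly_continuous_on ({0..1} \<times> cball 0 1) (\<lambda>(\<tau>, s). G \<tau> s)"
    by (intro compact_uniformly_continuous contG compact_Times compact_Icc compact_cball)
  then obtain \<delta> where \<delta>: "\<delta> > 0" "\<And>x x'. x \<in> {0..1} \<times> cball 0 1 \<Longrightarrow> x' \<in> {0..1} \<times> cball 0 1 \<Longrightarrow>
      dist x' x < \<delta> \<Longrightarrow> dist (case x' of (\<tau>, s) \<Rightarrow> G \<tau> s) (case x of (\<tau>, s) \<Rightarrow> G \<tau> s) < norm (ev v p)"
    unfolding uniformly_continuous_on_def using v by (metis zero_less_norm_iff)
  have Gnz: "G \<tau> s \<noteq> 0" if "\<tau> \<in> {0..1}" "norm s \<le> 1" "norm s < \<delta>" for \<tau> s
  proof
    assume "G \<tau> s = 0"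
    moreover have "dist (G \<tau> s) (G \<tau> 0) < norm (ev v p)"
      using \<delta>(2)[of "(\<tau>, 0)" "(\<tau>, s)"] that by (simp add: dist_prod_def)
    ultimately show False by (simp add: G_def)
  qed
  \<comment> \<open>Beyond \<open>R\<close> the inverse of \<open>z\<close> lies in the unit disc
    and within \<open>\<delta>\<close> of 0.\<close>
  define R where "R = max 1 (1 / \<delta>) + 1"
  have bdd: "norm z \<le> R" if "\<tau> \<in> {0..1}" "F \<tau> z = 0" for \<tau> z
  proof (rule ccontr)
    assume "\<not> norm z \<le> R"
    then have z: "norm z > 1" "norm z > 1 / \<delta>" by (auto simp: R_def)
    then have "z \<noteq> 0" by auto
    have "norm (inverse z) \<le> 1" "norm (inverse z) < \<delta>"
      using z \<delta>(1) \<open>z \<noteq> 0\<close>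
      by (simp_all add: norm_inverse norm_divide pos_divide_less_eq pos_divide_le_eq inverse_eq_divide mult.commute)
    then have "G \<tau> (inverse z) \<noteq> 0" using Gnz that(1) by blast
    moreover have "F \<tau> z = z ^ d * G \<tau> (inverse z)"
      using fhom_line[OF hom \<open>z \<noteq> 0\<close>] by (simp add: F_P P_def G_def poly_line)
    ultimately show False using that(2) \<open>z \<noteq> 0\<close> by simp
  qed
  define A where "A = {\<tau> \<in> {0..1}. \<exists>z. Im z \<ge> 0 \<and> F \<tau> z = 0}"
  define B where "B = {\<tau> \<in> {0..1}. \<forall>z. Im z \<ge> 0 \<longrightarrow> norm (ev v p) * Im z ^ d \<le> norm (F \<tau> z)}"
  \<comment> \<open>By \<open>bdd\<close> all zeros lie in one fixed ball, so \<open>A\<close> is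
    the projection of a compact set.\<close>
  have "closed A"
  proof -
    let ?Z = "({0..1} \<times> (cball 0 R \<inter> {z. Im z \<ge> 0})) \<inter> {x. (case x of (\<tau>, z) \<Rightarrow> F \<tau> z) = 0}"
    have "compact ?Z"
    proof (rule compact_Int_closed)
      show "compact ({0..1::real} \<times> (cball 0 R \<inter> {z. Im z \<ge> 0}))"
        by (intro compact_Times compact_Int_closed compact_Icc compact_cball closed_halfspace_Im_ge)
      show "closed {x. (case x of (\<tau>, z) \<Rightarrow> F \<tau> z) = 0}"
        using contF by (intro closed_Collect_eq) auto
    qed
    then have "compact (fst ` ?Z)"
      by (intro compact_continuous_image continuous_intros)
    moreover have "fst ` ?Z = A"
      using bdd unfolding A_def by (force simp: image_iff)
    ultimately show ?thesis by (simp add: compact_imp_closed)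
  qed
  moreover have "closed B"
  proof -
    have "continuous_on UNIV (\<lambda>\<tau>. F \<tau> z)" for z
      unfolding F_def ev_def msubst_def by (intro continuous_intros)
    then have "closed {\<tau>. norm (ev v p) * Im z ^ d \<le> norm (F \<tau> z)}" for z
      by (intro closed_Collect_le continuous_intros)
    then have "closed ({0..1} \<inter> (\<Inter>z\<in>{z. Im z \<ge> 0}. {\<tau>. norm (ev v p) * Im z ^ d \<le> norm (F \<tau> z)}))"
      by (intro closed_Int closed_INT) auto
    also have "{0..1} \<inter> (\<Inter>z\<in>{z. Im z \<ge> 0}. {\<tau>. norm (ev v p) * Im z ^ d \<le> norm (F \<tau> z)}) = B"
      by (auto simp: B_def)
    finally show ?thesis .
  qed
  moreover have "{0..1} \<subseteq> A \<union> B"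
  proof
    fix \<tau> :: real
    assume \<tau>: "\<tau> \<in> {0..1}"
    show "\<tau> \<in> A \<union> B"
    proof (cases "\<tau> \<in> A")
      case False
      then have "poly (P \<tau>) z \<noteq> 0" if "Im z \<ge> 0" for z
        using \<tau> that by (auto simp: A_def F_P)
      then have "norm (ev v p) * Im z ^ d \<le> norm (F \<tau> z)" if "Im z \<ge> 0" for z
        using lower_roots_norm_ge[of "P \<tau>" z, unfolded lead, unfolded deg] that
        unfolding F_P by blast
      with \<tau> show ?thesis by (simp add: B_def)
    qed simp
  qed
  \<comment> \<open>A zero with \<open>Im z >= 0\<close> is not real by \<open>avoid\<close>, so
    \<open>Im z > 0\<close> and the lower bound defining \<open>B\<close> would be positive.\<close>
  moreover have "A \<inter> B \<inter> {0..1} = {}"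
  proof -
    have "\<tau> \<notin> B" if "\<tau> \<in> A" for \<tau>
    proof
      assume "\<tau> \<in> B"
      from that obtain z where z: "Im z \<ge> 0" "F \<tau> z = 0" "\<tau> \<in> {0..1}" by (auto simp: A_def)
      then have "z \<notin> \<real>" using avoid[of \<tau> z] by (auto simp: F_def)
      then have "Im z > 0" using z by (metis complex_is_Real_iff le_less)
      then have "norm (ev v p) * Im z ^ d > 0" using v by simp
      moreover have "norm (ev v p) * Im z ^ d \<le> 0" using \<open>\<tau> \<in> B\<close> z by (auto simp: B_def)
      ultimately show False by simp
    qed
    then show ?thesis by auto
  qed
  moreover have "0 \<notin> A" using start by (auto simp: A_def F_def)
  moreover from this have "0 \<in> B" using \<open>{0..1} \<subseteq> A \<union> B\<close> by (metis UnE atLeastAtMost_iff order_refl subsetD zero_le_one)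
  \<comment> \<open>The disjoint closed sets \<open>A\<close> and \<open>B\<close> cover a connected
    interval, and 0 lies in \<open>B\<close>.\<close>
  ultimately have "A \<inter> {0..1} = {}"
    using connected_Icc[of "0::real" 1] unfolding connected_closed
    by (metis IntI atLeastAtMost_iff empty_iff order_refl zero_le_one)
  then have "1 \<notin> A" by auto
  with \<open>Im z \<ge> 0\<close> show ?thesis by (auto simp: A_def F_def)
qed

lemma fhom_along_degree: "degree (along p a b) \<le> d"
  and fhom_along_coeff: "coeff (along p a b) d = meval p b"
  if "fhom d p"
proof -
  let ?L = "line (\<lambda>i. of_real (a $ i)) (\<lambda>i. of_real (b $ i)) p :: complex poly"
  have "degree ?L = degree (along p a b)"
    unfolding map_poly_along[symmetric] by (simp add: degree_map_poly)
  then show "degree (along p a b) \<le> d" using fhom_line_degree[OF that] by metis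
  have "complex_of_real (coeff (along p a b) d) = coeff ?L d"
    unfolding map_poly_along[symmetric] by (simp add: coeff_map_poly)
  also have "\<dots> = of_real (meval p b)"
    using fhom_line_coeff[OF that] by (simp add: of_real_meval)
  finally show "coeff (along p a b) d = meval p b" by simp
qed

lemma fhomD:
  fixes c :: complex
  assumes "fhom d p" "c \<noteq> 0"
  shows "ev (\<lambda>i. c * x i) p = c ^ d * ev x p"
  using assms unfolding fhom_def by blast

section \<open>Hyperbolic polynomials and their admissible vectors\<close>

locale hyperbolic_pair =
  fixes h :: "'n::finite rpoly" and e :: "real ^ 'n" and d :: nat
  assumes homogeneous: "homogeneous d h"
    and nonzero: "meval h e \<noteq> 0"
    and real_zeros: "only_real_zeros (along h (- x) e)"
begin

lemma fhom: "fhom d h"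
  using homogeneous by (rule fhom_homogeneous)

lemma along_nonzero: "along h a e \<noteq> 0"
  using fhom_along_coeff[OF fhom, of a e] nonzero by auto

lemma degree_along: "degree (along h a e) = d"
  using fhom_along_coeff[OF fhom, of a e] fhom_along_degree[OF fhom, of a e] nonzero
  by (metis le_antisym le_degree)

text \<open>\<open>proots\<close> lists the zeros because the restriction to a line along
  \<open>e\<close> is not the zero polynomial.\<close>

lemma mem_hyperbolicity_cone_iff:
  "v \<in> hyperbolicity_cone h e \<longleftrightarrow> (\<forall>t<0. meval h (t *\<^sub>R e - v) \<noteq> 0)"
proof -
  have "t \<in># eigenvalues h e v \<longleftrightarrow> meval h (t *\<^sub>R e - v) = 0" for t
    using along_nonzero by (simp add: eigenvalues_def set_count_proots poly_along)
  then show ?thesis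
    by (auto simp: hyperbolicity_cone_def not_le[symmetric])
qed

definition H :: "real ^ 'n \<Rightarrow> real ^ 'n \<Rightarrow> complex"
  where "H w u = ev (\<lambda>i. Complex (w $ i) (u $ i)) h"

lemma H_eq_poly_along: "H w (r *\<^sub>R v) = poly (map_poly of_real (along h w v)) (\<i> * of_real r)"
  unfolding map_poly_along poly_line H_def
  by (rule arg_cong[where f = "\<lambda>x. ev x h"]) (auto simp: complex_eq_iff)

text \<open>A zero here would be the non-real zero \<open>i \<sigma>\<close> of the restriction of
  \<open>h\<close> to the line through \<open>w\<close> along \<open>e\<close>.\<close>

lemma H_direction_nonzero:
  assumes "\<sigma> > 0"
  shows "H w (\<sigma> *\<^sub>R e) \<noteq> 0"
proof
  assume "H w (\<sigma> *\<^sub>R e) = 0"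
  then have "\<i> * of_real \<sigma> \<in> \<real>"
    using real_zeros[of "- w"] unfolding H_eq_poly_along only_real_zeros_def by simp
  with assms show False by (simp add: complex_is_Real_iff)
qed

text \<open>Perturbing \<open>v\<close> by \<open>\<epsilon> e\<close> moves it into the interior of the cone.\<close>

lemma interior_zeros_below:
  assumes "v \<in> hyperbolicity_cone h e" "\<epsilon> > 0" "\<sigma> > 0" "Im z \<ge> 0"
  shows "ev (\<lambda>i. \<i> * of_real \<sigma> * of_real (e $ i) + z * of_real (v $ i + \<epsilon> * e $ i)) h \<noteq> 0"
proof (cases "z = 0")
  case True
  have "ev (\<lambda>i. (\<i> * of_real \<sigma>) * of_real (e $ i)) h = (\<i> * of_real \<sigma>) ^ d * of_real (meval h e)"
    unfolding of_real_meval using assms(3) by (intro fhomD fhom) simp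
  then show ?thesis using True assms(3) nonzero by simp
next
  case False
  \<comment> \<open>Chosen so that
    \<open>i \<sigma> e + z (v + \<epsilon> e) = - z (- v + t e)\<close>. A zero makes
    \<open>t\<close> an eigenvalue of \<open>v\<close>, hence real and nonnegative, and then the
    imaginary parts in \<open>i \<sigma> = - z (t + \<epsilon>)\<close> have incompatible
    signs.\<close>
  define t where "t = - (\<i> * of_real \<sigma> / z + of_real \<epsilon>)"
  have "(\<lambda>i. \<i> * of_real \<sigma> * of_real (e $ i) + z * of_real (v $ i + \<epsilon> * e $ i)) =
      (\<lambda>i. (- z) * (of_real ((- v) $ i) + t * of_real (e $ i)))"
    using False by (auto simp: t_def field_simps)
  moreover have "ev (\<lambda>i. (- z) * (of_real ((- v) $ i) + t * of_real (e $ i))) h =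
      (- z) ^ d * poly (map_poly of_real (along h (- v) e)) t"
    unfolding map_poly_along poly_line using False by (intro fhomD fhom) simp
  ultimately have "ev (\<lambda>i. \<i> * of_real \<sigma> * of_real (e $ i) + z * of_real (v $ i + \<epsilon> * e $ i)) h =
      (- z) ^ d * poly (map_poly of_real (along h (- v) e)) t"
    by (simp only:)
  moreover have "poly (map_poly of_real (along h (- v) e)) t \<noteq> 0"
  proof
    assume zero: "poly (map_poly of_real (along h (- v) e)) t = 0"
    then have "t \<in> \<real>" using real_zeros[of v] unfolding only_real_zeros_def by blast
    then obtain r where r: "t = of_real r" by (elim Reals_cases)
    with zero have "poly (along h (- v) e) r = 0" by (simp add: poly_map_poly_of_real)
    then have "meval h (r *\<^sub>R e - v) = 0" by (simp add: poly_along)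
    with assms(1) have "r \<ge> 0" unfolding mem_hyperbolicity_cone_iff by (metis not_le)
    have "\<i> * of_real \<sigma> = - (z * (t + of_real \<epsilon>))" using False by (simp add: t_def field_simps)
    then have "\<sigma> = - (Im z * (r + \<epsilon>))" by (simp add: r complex_eq_iff)
    moreover have "Im z * (r + \<epsilon>) \<ge> 0" using assms \<open>r \<ge> 0\<close> by simp
    ultimately show False using assms(3) by simp
  qed
  ultimately show ?thesis using False by simp
qed

text \<open>Up to sign this is the value of \<open>h\<close> at \<open>- \<epsilon> e - v\<close>,
  and the negative number \<open>- \<epsilon>\<close> is no eigenvalue of \<open>v\<close>. It
  supplies the nonzero leading coefficient for \<open>zeros_stay_below\<close>.\<close>

lemma ev_interior_nonzero:
  assumes "v \<in> hyperbolicity_cone h e" "\<epsilon> > 0"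
  shows "ev (\<lambda>i. complex_of_real (v $ i + \<epsilon> * e $ i)) h \<noteq> 0"
proof
  assume zero: "ev (\<lambda>i. complex_of_real (v $ i + \<epsilon> * e $ i)) h = 0"
  have "ev (\<lambda>i. (- 1) * complex_of_real (v $ i + \<epsilon> * e $ i)) h =
      (- 1) ^ d * ev (\<lambda>i. complex_of_real (v $ i + \<epsilon> * e $ i)) h"
    by (intro fhomD fhom) simp
  also have "(\<lambda>i. (- 1) * complex_of_real (v $ i + \<epsilon> * e $ i)) =
      (\<lambda>i. of_real (((- \<epsilon>) *\<^sub>R e - v) $ i))"
    by (auto simp: algebra_simps)
  finally have "complex_of_real (meval h ((- \<epsilon>) *\<^sub>R e - v)) = 0"
    unfolding of_real_meval zero by simp
  then have "meval h ((- \<epsilon>) *\<^sub>R e - v) = 0" by (simp only: of_real_eq_0_iff)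
  then show False using assms unfolding mem_hyperbolicity_cone_iff by (metis neg_less_0_iff_less)
qed

text \<open>The whole ray in \<open>u\<close> is tested because the path of base points in
  \<open>K_add_cone\<close> scales \<open>u\<close> down to zero.\<close>

definition K :: "(real ^ 'n) set"
  where "K = {u. \<forall>w \<sigma> \<tau>. \<sigma> > 0 \<longrightarrow> \<tau> \<ge> 0 \<longrightarrow> H w (\<sigma> *\<^sub>R e + \<tau> *\<^sub>R u) \<noteq> 0}"

lemma KD: "u \<in> K \<Longrightarrow> \<sigma> > 0 \<Longrightarrow> \<tau> \<ge> 0 \<Longrightarrow> H w (\<sigma> *\<^sub>R e + \<tau> *\<^sub>R u) \<noteq> 0"
  by (simp add: K_def)

lemma zero_in_K: "0 \<in> K"
  by (simp add: K_def H_direction_nonzero)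

text \<open>Half of \<open>\<sigma> e\<close> stays in the base point, the other half pushes
  \<open>v\<close> into the interior of the cone. The base point runs through
  \<open>i (\<sigma> / 2) e + s (w + i \<tau> u)\<close>; for real \<open>z\<close> the imaginary
  part is \<open>(\<sigma> / 2) e + s \<tau> u\<close>, where admissibility of \<open>u\<close>
  excludes zeros.\<close>

lemma K_add_cone:
  assumes "u \<in> K" "v \<in> hyperbolicity_cone h e" "c \<ge> 0"
  shows "u + c *\<^sub>R v \<in> K"
  unfolding K_def
proof (intro CollectI allI impI)
  fix w \<sigma> \<tau>
  assume \<sigma>: "\<sigma> > (0::real)" and \<tau>: "\<tau> \<ge> (0::real)"
  show "H w (\<sigma> *\<^sub>R e + \<tau> *\<^sub>R (u + c *\<^sub>R v)) \<noteq> 0"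
  proof (cases "\<tau> * c = 0")
    case True
    then have "\<tau> *\<^sub>R (u + c *\<^sub>R v) = \<tau> *\<^sub>R u" by (auto simp: scaleR_add_right)
    then show ?thesis using KD[OF assms(1) \<sigma> \<tau>] by (simp only:) simp
  next
    case False
    define r where "r = \<tau> * c"
    have r: "r > 0" using False \<tau> assms(3) by (simp add: r_def less_le)
    \<comment> \<open>Gives \<open>r \<epsilon> = \<sigma> / 2\<close>, so that at
      \<open>z = i r\<close> the two halves add up to \<open>\<sigma> e\<close>.\<close>
    define \<epsilon> where "\<epsilon> = \<sigma> / (2 * r)"
    have \<epsilon>: "\<epsilon> > 0" "r * \<epsilon> = \<sigma> / 2" using \<sigma> r by (auto simp: \<epsilon>_def)
    let ?a = "\<lambda>i. \<i> * of_real (\<sigma> / 2) * of_real (e $ i)"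
    let ?b = "\<lambda>i. Complex (w $ i) (\<tau> * u $ i)"
    let ?v = "\<lambda>i. complex_of_real (v $ i + \<epsilon> * e $ i)"
    have "ev (\<lambda>i. ?a i + ?b i + (\<i> * of_real r) * ?v i) h \<noteq> 0"
    proof (rule zeros_stay_below[OF fhom])
      show "ev ?v h \<noteq> 0" using assms(2) \<epsilon>(1) by (rule ev_interior_nonzero)
      show "ev (\<lambda>i. ?a i + z * ?v i) h \<noteq> 0" if "Im z \<ge> 0" for z
        using assms(2) \<epsilon>(1) _ that by (rule interior_zeros_below) (use \<sigma> in simp)
      show "ev (\<lambda>i. ?a i + of_real s * ?b i + z * ?v i) h \<noteq> 0"
        if s: "0 \<le> s" "s \<le> 1" and z: "z \<in> \<real>" for s z
      proof -
        obtain q where q: "z = of_real q" using z by (elim Reals_cases)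
        have "H (s *\<^sub>R w + q *\<^sub>R (v + \<epsilon> *\<^sub>R e)) ((\<sigma> / 2) *\<^sub>R e + (s * \<tau>) *\<^sub>R u) \<noteq> 0"
          using assms(1) _ _ by (rule KD) (use \<sigma> \<tau> s in auto)
        moreover have "(\<lambda>i. ?a i + of_real s * ?b i + z * ?v i) =
            (\<lambda>i. Complex ((s *\<^sub>R w + q *\<^sub>R (v + \<epsilon> *\<^sub>R e)) $ i) (((\<sigma> / 2) *\<^sub>R e + (s * \<tau>) *\<^sub>R u) $ i))"
          by (auto simp: q complex_eq_iff algebra_simps)
        ultimately show ?thesis by (simp add: H_def)
      qed
      show "Im (\<i> * of_real r) \<ge> 0" using r by simp
    qed
    moreover have "(\<lambda>i. ?a i + ?b i + (\<i> * of_real r) * ?v i) =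
        (\<lambda>i. Complex (w $ i) ((\<sigma> *\<^sub>R e + \<tau> *\<^sub>R (u + c *\<^sub>R v)) $ i))"
    proof
      fix i
      have "\<sigma> / 2 * e $ i + \<tau> * u $ i + r * (v $ i + \<epsilon> * e $ i) =
          \<sigma> / 2 * e $ i + \<tau> * u $ i + r * v $ i + (r * \<epsilon>) * e $ i" by (simp add: algebra_simps)
      also have "\<dots> = \<sigma> * e $ i + \<tau> * (u $ i + c * v $ i)"
        unfolding \<epsilon>(2) by (simp add: r_def algebra_simps)
      finally show "?a i + ?b i + (\<i> * of_real r) * ?v i =
          Complex (w $ i) ((\<sigma> *\<^sub>R e + \<tau> *\<^sub>R (u + c *\<^sub>R v)) $ i)"
        by (simp add: complex_eq_iff)
    qed
    ultimately show ?thesis by (simp add: H_def)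
  qed
qed

text \<open>The next set contains the hyperbolicity cone and is visibly a convex cone, which spares us a
  proof that the hyperbolicity cone itself is convex.\<close>

definition N :: "(real ^ 'n) set"
  where "N = {v. \<forall>u\<in>K. \<forall>c\<ge>0. u + c *\<^sub>R v \<in> K}"

lemma cone_subset_N: "hyperbolicity_cone h e \<subseteq> N"
  by (auto simp: N_def K_add_cone)

lemma N_zero: "0 \<in> N"
  by (simp add: N_def)

lemma N_add: "v \<in> N \<Longrightarrow> v' \<in> N \<Longrightarrow> v + v' \<in> N"
  by (simp add: N_def scaleR_add_right flip: add.assoc)

lemma N_scaleR: "v \<in> N \<Longrightarrow> c \<ge> 0 \<Longrightarrow> c *\<^sub>R v \<in> N"
  by (simp add: N_def)

lemma N_sum:
  assumes "\<And>a. a \<in> A \<Longrightarrow> f a \<in> N"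
  shows "(\<Sum>a\<in>A. f a) \<in> N"
  using assms by (induction A rule: infinite_finite_induct) (simp_all add: N_zero N_add)

section \<open>The zero-free tube over \<open>T\<close> and its preservation by the mixing
  operators\<close>

definition T :: "(real ^ 'n) set"
  where "T = {\<sigma> *\<^sub>R e + u | \<sigma> u. \<sigma> > 0 \<and> u \<in> K}"

lemma T_add: "y \<in> T \<Longrightarrow> v \<in> N \<Longrightarrow> c \<ge> 0 \<Longrightarrow> y + c *\<^sub>R v \<in> T"
  unfolding T_def N_def by (auto simp: add.assoc) blast

lemma T_direction: "\<sigma> > 0 \<Longrightarrow> \<sigma> *\<^sub>R e \<in> T"
  unfolding T_def using zero_in_K by (intro CollectI exI[of _ \<sigma>] exI[of _ 0]) simp

lemma H_nonzero: "y \<in> T \<Longrightarrow> H w y \<noteq> 0"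
  unfolding T_def using KD[of _ _ 1] by auto

text \<open>The auxiliary variables are kept real, as \<open>lower_roots_shift_deriv\<close>
  concerns real \<open>y\<close>.\<close>

definition stable :: "('n + 'm::finite) rpoly \<Rightarrow> bool"
  where "stable p \<longleftrightarrow>
    (\<forall>x. (\<forall>j. Im (x (Inr j)) = 0) \<longrightarrow> (\<chi> k. Im (x (Inl k))) \<in> T \<longrightarrow> ev x p \<noteq> 0)"

lemma stable_lift: "stable (lift_rpoly h)"
  unfolding stable_def ev_lift_rpoly
proof (intro allI impI)
  fix x :: "'n + 'm \<Rightarrow> complex"
  assume "(\<chi> k. Im (x (Inl k))) \<in> T"
  then have "H (\<chi> k. Re (x (Inl k))) (\<chi> k. Im (x (Inl k))) \<noteq> 0" by (rule H_nonzero)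
  then show "ev (\<lambda>k. x (Inl k)) h \<noteq> 0" by (simp add: H_def)
qed

text \<open>Moving from \<open>x\<close> by \<open>z v\<close> with \<open>Im z >= 0\<close> adds a
  nonnegative multiple of \<open>v\<close> to the imaginary part and stays in the tube, so the zeros
  along this line lie in the lower half-plane.\<close>

lemma stable_mixing_op:
  fixes p :: "('n + 'm::finite) rpoly"
  assumes "stable p" "v \<in> N"
  shows "stable (mixing_op j v p)"
  unfolding stable_def
proof (intro allI impI)
  fix x :: "'n + 'm \<Rightarrow> complex"
  assume real: "\<forall>j. Im (x (Inr j)) = 0" and T: "(\<chi> k. Im (x (Inl k))) \<in> T"
  let ?P = "line x (\<lambda>i. of_real (pad v $ i)) p"
  have "poly ?P z \<noteq> 0" if "Im z \<ge> 0" for z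
  proof -
    have "(\<chi> k. Im (x (Inl k) + z * of_real (pad v $ (Inl k :: 'n + 'm)))) =
        (\<chi> k. Im (x (Inl k))) + Im z *\<^sub>R v"
      by (simp add: vec_eq_iff pad_def)
    then have "(\<chi> k. Im (x (Inl k) + z * of_real (pad v $ (Inl k :: 'n + 'm)))) \<in> T"
      using T_add[OF T assms(2) that] by simp
    then show ?thesis
      using assms(1) real unfolding stable_def poly_line by (simp add: pad_def)
  qed
  then have "poly ?P 0 - of_real (Re (x (Inr j))) * poly (pderiv ?P) 0 \<noteq> 0"
    by (rule lower_roots_shift_deriv)
  moreover have "of_real (Re (x (Inr j))) = x (Inr j)" using real by (simp add: complex_eq_iff)
  ultimately show "ev x (mixing_op j v p) \<noteq> 0"
    unfolding ev_mixing_op poly_pderiv_line by (simp add: poly_line)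
qed

end

section \<open>The mixed polynomials\<close>

lemma fold_mixing_op_insert:
  assumes "finite J" "j \<notin> J"
  shows "Finite_Set.fold (\<lambda>i. mixing_op i (v i)) p (insert j J) =
    mixing_op j (v j) (Finite_Set.fold (\<lambda>i. mixing_op i (v i)) p J)"
proof -
  interpret comp_fun_commute "\<lambda>i. mixing_op i (v i)" by (rule comp_fun_commute_mixing_op)
  show ?thesis using assms by simp
qed

lemma fold_mixing_op_induct:
  assumes "finite J" "P p" "\<And>j q. P q \<Longrightarrow> P (mixing_op j (v j) q)"
  shows "P (Finite_Set.fold (\<lambda>i. mixing_op i (v i)) p J)"
  using assms(1)
  by (induction J rule: finite_induct) (simp_all add: fold_mixing_op_insert assms)

lemma fold_mixing_op_cong:
  assumes "finite J" "\<And>j. j \<in> J \<Longrightarrow> v j = v' j"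
  shows "Finite_Set.fold (\<lambda>i. mixing_op i (v i)) p J = Finite_Set.fold (\<lambda>i. mixing_op i (v' i)) p J"
  using assms
  by (induction J rule: finite_induct) (simp_all add: fold_mixing_op_insert)

lemma pad_lincomb: "pad (\<Sum>a\<in>A. c a *\<^sub>R u a) = (\<Sum>a\<in>A. c a *\<^sub>R pad (u a))"
  by (auto simp: vec_eq_iff pad_def split: sum.split)

text \<open>The derivative is linear in the direction, and weights with sum 1 reproduce the
  undifferentiated term.\<close>

lemma meval_mixing_op_average:
  assumes "(\<Sum>a\<in>A. c a) = 1"
  shows "meval (mixing_op j (\<Sum>a\<in>A. c a *\<^sub>R a) p) x = (\<Sum>a\<in>A. c a * meval (mixing_op j a p) x)"
  unfolding meval_eq_ev ev_mixing_op pad_lincomb dirderiv_lincomb ev_sum ev_mult ev_mconst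
  using assms
  by (simp add: right_diff_distrib sum_subtractf sum_distrib_left sum_distrib_right[symmetric] mult.left_commute)

text \<open>As the operators commute, the one with index \<open>j\<close> can be applied last; hence
  \<open>mixed h v\<close> is affine in each direction separately.\<close>

lemma meval_mixed_average:
  fixes v :: "'m::finite \<Rightarrow> real ^ 'n::finite"
  assumes "(\<Sum>a\<in>A. c a) = 1"
  shows "meval (mixed h (v(j := \<Sum>a\<in>A. c a *\<^sub>R a))) x = (\<Sum>a\<in>A. c a * meval (mixed h (v(j := a))) x)"
proof -
  have "mixed h (v(j := u)) =
      mixing_op j u (Finite_Set.fold (\<lambda>i. mixing_op i (v i)) (lift_rpoly h) (UNIV - {j}))" for u
  proof -
    have "mixed h (v(j := u)) =
        Finite_Set.fold (\<lambda>i. mixing_op i ((v(j := u)) i)) (lift_rpoly h) (insert j (UNIV - {j}))"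
      by (simp add: mixed_def insert_absorb)
    also have "\<dots> = mixing_op j ((v(j := u)) j)
        (Finite_Set.fold (\<lambda>i. mixing_op i ((v(j := u)) i)) (lift_rpoly h) (UNIV - {j}))"
      by (rule fold_mixing_op_insert) auto
    also have "Finite_Set.fold (\<lambda>i. mixing_op i ((v(j := u)) i)) (lift_rpoly h) (UNIV - {j}) =
        Finite_Set.fold (\<lambda>i. mixing_op i (v i)) (lift_rpoly h) (UNIV - {j})"
      by (rule fold_mixing_op_cong) auto
    finally show ?thesis by (simp only: fun_upd_same)
  qed
  then show ?thesis by (simp only: meval_mixing_op_average[OF assms])
qed

lemma fhom_mixed: "fhom d (mixed h v)" if "fhom d h"
proof -
  have "fhom d (lift_rpoly h)"
    unfolding fhom_def ev_lift_rpoly by (intro allI impI fhomD[OF that])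
  then show ?thesis
    unfolding mixed_def
    by (rule fold_mixing_op_induct[where P = "fhom d", rotated]) (simp_all add: fhom_mixing_op)
qed

text \<open>At \<open>pad x\<close> all auxiliary variables vanish and each operator leaves the
  value unchanged. This makes the leading coefficient along \<open>pad e\<close> independent of
  \<open>v\<close>.\<close>

lemma meval_mixed_pad: "meval (mixed h v) (pad x) = meval h x"
proof -
  have "meval (lift_rpoly h) (pad x) = meval h x"
    by (simp add: meval_eq_ev ev_lift_rpoly pad_def)
  then show ?thesis
    unfolding mixed_def
    by (rule fold_mixing_op_induct[where P = "\<lambda>p. meval p (pad x) = meval h x", rotated])
       (simp_all add: meval_eq_ev ev_mixing_op pad_def)
qed

text \<open>Where \<open>h\<close> is affine in the directions \<open>v j\<close>, Taylor's formula turns \<open>1 - y\<^sub>j D\<^bsub>v j\<^esub>\<close> into the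
  translation by \<open>- y\<^sub>j v j\<close>.\<close>

lemma meval_mixed_affine:
  fixes h :: "'n::finite rpoly" and v :: "'m::finite \<Rightarrow> real ^ 'n"
  assumes "\<And>j w. degree (along h w (v j)) \<le> 1"
  shows "meval (mixed h v) x = meval h ((\<chi> k. x $ Inl k) - (\<Sum>j\<in>UNIV. x $ Inr j *\<^sub>R v j))"
proof -
  have "meval (Finite_Set.fold (\<lambda>i. mixing_op i (v i)) (lift_rpoly h) J) x =
      meval h ((\<chi> k. x $ Inl k) - (\<Sum>j\<in>J. x $ Inr j *\<^sub>R v j))" if "finite J" for J x
    using that
  proof (induction J arbitrary: x rule: finite_induct)
    case empty
    then show ?case by (simp add: meval_eq_ev ev_lift_rpoly)
  next
    case (insert j J)
    let ?p = "Finite_Set.fold (\<lambda>i. mixing_op i (v i)) (lift_rpoly h) J"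
    let ?s = "\<lambda>x. (\<chi> k. x $ Inl k) - (\<Sum>j\<in>J. x $ Inr j *\<^sub>R v j)"
    \<comment> \<open>The induction hypothesis holds at every point, hence as an identity of
      polynomials along the line, which can be differentiated. Moving along \<open>pad (v j)\<close>
      leaves the auxiliary variables, and so the translation, unchanged.\<close>
    have "along ?p x (pad (v j)) = along h (?s x) (v j)"
    proof (rule poly_eq_poly_eq_iff[THEN iffD1], rule ext)
      fix t
      have "?s (x + t *\<^sub>R pad (v j)) = ?s x + t *\<^sub>R v j"
        by (simp add: vec_eq_iff pad_def)
      then show "poly (along ?p x (pad (v j))) t = poly (along h (?s x) (v j)) t"
        by (simp only: poly_along insert.IH)
    qed
    moreover have "ev (($) x) (dirderiv (pad (v j)) ?p) = poly (pderiv (along ?p x (pad (v j)))) 0"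
      using poly_pderiv_line[of "($) x" "pad (v j)" ?p] by (simp add: along_eq_line)
    moreover have "meval ?p x = poly (along ?p x (pad (v j))) 0"
      by (simp add: poly_along)
    ultimately have "meval (mixing_op j (v j) ?p) x =
        poly (along h (?s x) (v j)) 0 - x $ Inr j * poly (pderiv (along h (?s x) (v j))) 0"
      by (simp add: meval_eq_ev ev_mixing_op)
    also have "\<dots> = poly (along h (?s x) (v j)) (- (x $ Inr j))"
    proof -
      have "poly q 0 - y * poly (pderiv q) 0 = poly q (- y)" if "degree q \<le> 1" for q :: "real poly" and y
      proof -
        have "q = [:coeff q 0, coeff q 1:]"
          using that by (intro poly_eqI) (auto simp: coeff_pCons coeff_eq_0 split: nat.split)
        then obtain a b where "q = [:a, b:]" by blast
        then show ?thesis by (simp add: pderiv_pCons)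
      qed
      then show ?thesis using assms by blast
    qed
    also have "\<dots> = meval h ((\<chi> k. x $ Inl k) - (\<Sum>j\<in>insert j J. x $ Inr j *\<^sub>R v j))"
      using insert.hyps by (simp add: poly_along algebra_simps)
    finally show ?case using insert.hyps by (simp add: fold_mixing_op_insert)
  qed
  then show ?thesis by (simp add: mixed_def)
qed

section \<open>Real-rootedness along \<open>e\<close>, and the degree of \<open>h\<close> along cone
  vectors\<close>

context hyperbolic_pair
begin

lemma stableD:
  assumes "stable p" "\<forall>j. Im (x (Inr j)) = 0" "(\<chi> k. Im (x (Inl k))) \<in> T"
  shows "ev x p \<noteq> 0"
  using assms unfolding stable_def by blast

text \<open>For \<open>Im z > 0\<close> the imaginary part of the point is \<open>Im z\<close> times
  \<open>e\<close>, which lies in \<open>T\<close>. Real coefficients carry the absence of zeros to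
  the lower half-plane by conjugation.\<close>

lemma real_rooted_mixed:
  fixes v :: "'m::finite \<Rightarrow> real ^ 'n"
  assumes "\<And>j. v j \<in> N"
  shows "real_rooted (along (mixed h v) w (pad e))"
proof -
  have "stable (mixed h v)"
    unfolding mixed_def
    by (rule fold_mixing_op_induct[where P = stable]) (simp_all add: stable_lift stable_mixing_op assms)
  then have upper: "poly (map_poly of_real (along (mixed h v) w (pad e))) z \<noteq> 0" if "Im z > 0" for z
  proof -
    let ?x = "\<lambda>i. of_real (w $ i) + z * of_real (pad e $ i)"
    have "(\<chi> k. Im (?x (Inl k))) = Im z *\<^sub>R e" by (simp add: vec_eq_iff pad_def)
    then have "(\<chi> k. Im (?x (Inl k))) \<in> T" using T_direction[OF that] by (simp only:)
    moreover have "\<forall>j. Im (?x (Inr j)) = 0" by (simp add: pad_def)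
    ultimately show ?thesis
      unfolding map_poly_along poly_line using \<open>stable (mixed h v)\<close> by (intro stableD)
  qed
  have "z \<in> \<real>" if zero: "poly (map_poly of_real (along (mixed h v) w (pad e))) z = 0" for z :: complex
  proof (rule ccontr)
    assume "z \<notin> \<real>"
    then have "Im z > 0 \<or> Im (cnj z) > 0" unfolding complex_is_Real_iff complex_cnj(1) by simp linarith
    moreover have "poly (map_poly of_real (along (mixed h v) w (pad e))) (cnj z) =
        cnj (poly (map_poly of_real (along (mixed h v) w (pad e))) z)"
      unfolding map_poly_along poly_line cnj_ev by simp
    ultimately show False using upper zero by (metis complex_cnj_zero)
  qed
  then show ?thesis by (simp add: real_rooted_def only_real_zeros_def)
qed

lemma
  fixes v :: "'m::finite \<Rightarrow> real ^ 'n"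
  shows degree_mixed: "degree (along (mixed h v) w (pad e)) = d"
  and lead_coeff_mixed: "lead_coeff (along (mixed h v) w (pad e)) = meval h e"
proof -
  have *: "degree (along (mixed h v) w (pad e)) \<le> d"
    "coeff (along (mixed h v) w (pad e)) d = meval h e"
    using fhom_along_degree[OF fhom_mixed[OF fhom], of v w "pad e"]
      fhom_along_coeff[OF fhom_mixed[OF fhom], of v w "pad e"]
    by (simp_all add: meval_mixed_pad)
  with nonzero show "degree (along (mixed h v) w (pad e)) = d"
    by (metis le_antisym le_degree)
  with * show "lead_coeff (along (mixed h v) w (pad e)) = meval h e" by simp
qed

text \<open>Along \<open>a \<in> N\<close> all zeros lie in the lower half-plane, so a real unit step can be traded for an
  imaginary one at the cost of a constant factor.\<close>

lemma H_step_le: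
  assumes "y \<in> T" "a \<in> N" "\<bar>s\<bar> \<le> 1"
  shows "norm (H (w + s *\<^sub>R a) y) \<le> 3 ^ d * norm (H w (y + a))"
proof -
  let ?P = "line (\<lambda>i. Complex (w $ i) (y $ i)) (\<lambda>i. of_real (a $ i)) h"
  have P: "poly ?P z = H (w + Re z *\<^sub>R a) (y + Im z *\<^sub>R a)" for z
    unfolding poly_line H_def by (rule arg_cong[where f = "\<lambda>x. ev x h"]) (auto simp: complex_eq_iff)
  have "norm (poly ?P (of_real s)) \<le> 3 ^ degree ?P * norm (poly ?P \<i>)"
  proof (rule lower_roots_norm_le)
    show "poly ?P z \<noteq> 0" if "Im z \<ge> 0" for z
      unfolding P using T_add[OF assms(1,2) that] by (rule H_nonzero)
  qed (use assms(3) in simp)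
  also have "\<dots> \<le> 3 ^ d * norm (poly ?P \<i>)"
    by (intro mult_right_mono power_increasing fhom_line_degree[OF fhom]) auto
  finally show ?thesis by (simp add: P)
qed

lemma H_zero: "H 0 u = \<i> ^ d * of_real (meval h u)"
proof -
  have "(\<lambda>i. Complex (0 $ i) (u $ i)) = (\<lambda>i. \<i> * of_real (u $ i))"
    by (auto simp: complex_eq_iff)
  then show ?thesis
    unfolding H_def of_real_meval using fhomD[OF fhom, of \<i>] by simp
qed

text \<open>Adding \<open>M e\<close> shifts every eigenvalue by \<open>M\<close>, and
  \<open>M\<close> bounds the moduli of the eigenvalues of \<open>w\<close> and
  \<open>- w\<close>.\<close>

lemma cone_contains_large:
  "\<exists>M>0. \<forall>\<epsilon>. \<bar>\<epsilon>\<bar> = 1 \<longrightarrow> M *\<^sub>R e + \<epsilon> *\<^sub>R w \<in> hyperbolicity_cone h e"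
proof -
  let ?R = "{t. poly (along h (- w) e) t = 0} \<union> {t. poly (along h w e) t = 0}"
  have fin: "finite ?R"
    using along_nonzero by (simp add: poly_roots_finite)
  define M where "M = Max (insert 1 (abs ` ?R))"
  have M: "1 \<le> M" "\<And>t. t \<in> ?R \<Longrightarrow> \<bar>t\<bar> \<le> M"
    unfolding M_def using fin by (auto intro!: Max_ge)
  have "M *\<^sub>R e + \<epsilon> *\<^sub>R w \<in> hyperbolicity_cone h e" if "\<bar>\<epsilon>\<bar> = 1" for \<epsilon>
    unfolding mem_hyperbolicity_cone_iff
  proof (intro allI impI notI)
    fix t :: real
    assume t: "t < 0" and zero: "meval h (t *\<^sub>R e - (M *\<^sub>R e + \<epsilon> *\<^sub>R w)) = 0"
    have "t *\<^sub>R e - (M *\<^sub>R e + \<epsilon> *\<^sub>R w) = - (\<epsilon> *\<^sub>R w) + (t - M) *\<^sub>R e" by (simp add: algebra_simps)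
    with zero have "poly (along h (- (\<epsilon> *\<^sub>R w)) e) (t - M) = 0" by (simp add: poly_along)
    moreover have "\<epsilon> = 1 \<or> \<epsilon> = - 1" using that by linarith
    ultimately have "t - M \<in> ?R" by auto
    then show False using M t by force
  qed
  then show ?thesis using M(1) by (intro exI[of _ M]) simp
qed

text \<open>Trades the real part \<open>w\<close> for a fixed multiple of \<open>e\<close>, so that
  growth in \<open>r\<close> can be read off from the eigenvalues of \<open>v\<close>. The constant
  \<open>M\<close> depends on \<open>w\<close> only.\<close>

lemma H_le_meval:
  obtains M where "M > 0"
    "\<And>v r. v \<in> hyperbolicity_cone h e \<Longrightarrow> r \<ge> 0 \<Longrightarrow>
      norm (H w (r *\<^sub>R v)) \<le> 27 ^ d * \<bar>meval h (M *\<^sub>R e + r *\<^sub>R v)\<bar>"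
proof -
  obtain M where M: "M > 0" "\<And>\<epsilon>. \<bar>\<epsilon>\<bar> = 1 \<Longrightarrow> M *\<^sub>R e + \<epsilon> *\<^sub>R w \<in> hyperbolicity_cone h e"
    using cone_contains_large[of w] by blast
  have N: "M *\<^sub>R e + w \<in> N" "M *\<^sub>R e - w \<in> N"
    using M(2)[of 1] M(2)[of "- 1"] cone_subset_N by auto
  have "(1 / 2) *\<^sub>R ((M *\<^sub>R e + w) + (M *\<^sub>R e - w)) \<in> N"
    by (intro N_scaleR N_add N) simp
  moreover have "(1 / 2) *\<^sub>R ((M *\<^sub>R e + w) + (M *\<^sub>R e - w)) = M *\<^sub>R e"
    by (simp add: vec_eq_iff)
  ultimately have Ne: "M *\<^sub>R e \<in> N" by simp
  have bound: "norm (H w (\<sigma> *\<^sub>R e + r *\<^sub>R v)) \<le> 27 ^ d * \<bar>meval h ((\<sigma> + 3 * M) *\<^sub>R e + r *\<^sub>R v)\<bar>"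
    if v: "v \<in> hyperbolicity_cone h e" and r: "r \<ge> 0" and \<sigma>: "\<sigma> > 0" for v r \<sigma>
  proof -
    let ?y = "\<sigma> *\<^sub>R e + r *\<^sub>R v"
    have y: "?y \<in> T" using T_add[OF T_direction[OF \<sigma>] _ r] v cone_subset_N by blast
    then have y1: "?y + (M *\<^sub>R e + w) \<in> T" using T_add[OF y N(1), of 1] by simp
    then have y2: "?y + (M *\<^sub>R e + w) + M *\<^sub>R e \<in> T" using T_add[OF y1 Ne, of 1] by simp
    \<comment> \<open>Three unit steps, each costing \<open>3 ^ d\<close>: from real part
      \<open>w\<close> to \<open>- M e\<close>, then to 0, then a step with \<open>s = 0\<close>
      that cancels \<open>w\<close> in the imaginary part. The imaginary part grows by
      \<open>3 M e\<close> in total.\<close>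
    have "norm (H w ?y) \<le> 3 ^ d * norm (H (- (M *\<^sub>R e)) (?y + (M *\<^sub>R e + w)))"
      using H_step_le[OF y N(1), of 1 "- (M *\<^sub>R e)"] by simp
    also have "norm (H (- (M *\<^sub>R e)) (?y + (M *\<^sub>R e + w))) \<le>
        3 ^ d * norm (H 0 (?y + (M *\<^sub>R e + w) + M *\<^sub>R e))"
      using H_step_le[OF y1 Ne, of "- 1" 0] by simp
    also have "norm (H 0 (?y + (M *\<^sub>R e + w) + M *\<^sub>R e)) \<le>
        3 ^ d * norm (H 0 (?y + (M *\<^sub>R e + w) + M *\<^sub>R e + (M *\<^sub>R e - w)))"
      using H_step_le[OF y2 N(2), of 0 0] by simp
    also have "?y + (M *\<^sub>R e + w) + M *\<^sub>R e + (M *\<^sub>R e - w) = (\<sigma> + 3 * M) *\<^sub>R e + r *\<^sub>R v"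
      by (simp add: vec_eq_iff algebra_simps)
    finally have "norm (H w ?y) \<le> 3 ^ d * (3 ^ d * (3 ^ d * \<bar>meval h ((\<sigma> + 3 * M) *\<^sub>R e + r *\<^sub>R v)\<bar>))"
      by (simp add: H_zero norm_mult norm_power)
    also have "\<dots> = (3 * 3 * 3) ^ d * \<bar>meval h ((\<sigma> + 3 * M) *\<^sub>R e + r *\<^sub>R v)\<bar>"
      unfolding power_mult_distrib by simp
    finally show ?thesis by simp
  qed
  \<comment> \<open>The steps start in \<open>T\<close>, which requires \<open>\<sigma> > 0\<close>;
    the case \<open>\<sigma> = 0\<close> follows by continuity.\<close>
  have "norm (H w (r *\<^sub>R v)) \<le> 27 ^ d * \<bar>meval h ((3 * M) *\<^sub>R e + r *\<^sub>R v)\<bar>"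
    if v: "v \<in> hyperbolicity_cone h e" and r: "r \<ge> 0" for v r
  proof -
    let ?L = "\<lambda>\<sigma>. norm (H w (\<sigma> *\<^sub>R e + r *\<^sub>R v))"
    let ?R = "\<lambda>\<sigma>. 27 ^ d * \<bar>meval h ((\<sigma> + 3 * M) *\<^sub>R e + r *\<^sub>R v)\<bar>"
    have "isCont ?L 0"
      unfolding H_def Complex_eq ev_def msubst_def vector_add_component vector_scaleR_component
      by (intro continuous_intros)
    moreover have "isCont ?R 0"
      unfolding meval_eq_ev ev_def msubst_def vector_add_component vector_scaleR_component
      by (intro continuous_intros)
    ultimately have "(?L \<longlongrightarrow> ?L 0) (at_right 0)" "(?R \<longlongrightarrow> ?R 0) (at_right 0)"
      by (auto simp: isCont_def intro: tendsto_within_subset)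
    moreover have "eventually (\<lambda>\<sigma>. ?L \<sigma> \<le> ?R \<sigma>) (at_right 0)"
      using bound[OF v r] by (auto simp: eventually_at_right_field intro!: exI[of _ 1])
    ultimately have "?L 0 \<le> ?R 0" by (intro tendsto_le[of "at_right 0" ?R _ ?L]) auto
    then show ?thesis by simp
  qed
  then show ?thesis using that[of "3 * M"] M(1) by simp
qed

text \<open>By homogeneity the value is \<open>(- r) ^ d\<close> times \<open>A (- M / r)\<close>,
  and \<open>A\<close> vanishes at 0 to order \<open>d - k\<close>, where \<open>k\<close> is the
  rank. This leaves \<open>r ^ k\<close> times a bounded factor.\<close>

lemma meval_growth:
  assumes "M > 0"
  obtains C where "\<And>r. r \<ge> 1 \<Longrightarrow> \<bar>meval h (M *\<^sub>R e + r *\<^sub>R v)\<bar> \<le> C * r ^ hrank h e v"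
proof -
  define A where "A = along h (- v) e"
  define k where "k = hrank h e v"
  have "A \<noteq> 0" by (simp add: A_def along_nonzero)
  \<comment> \<open>All \<open>d\<close> zeros of \<open>A\<close> are real; those equal to 0 number
    \<open>order 0 A\<close>, the others are counted by the rank.\<close>
  have "d = size (proots A)"
    unfolding A_def using size_proots_only_real_zeros[OF real_zeros along_nonzero] by (simp add: degree_along)
  also have "\<dots> = size (filter_mset (\<lambda>l. l \<noteq> 0) (proots A) + filter_mset (\<lambda>l. \<not> l \<noteq> 0) (proots A))"
    by (simp only: multiset_partition[symmetric])
  also have "\<dots> = size (filter_mset (\<lambda>l. l \<noteq> 0) (proots A)) + size (filter_mset (\<lambda>l. l = 0) (proots A))"
    by (simp only: size_union not_not)
  also have "\<dots> = k + order 0 A"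
    using \<open>A \<noteq> 0\<close> by (simp add: k_def hrank_def eigenvalues_def A_def filter_eq_replicate_mset)
  finally have d: "d = k + order 0 A" .
  have "[:0, 1:] ^ order 0 A dvd A" using order_1[of 0 A] by simp
  then obtain B where B: "A = [:0, 1:] ^ order 0 A * B" by (elim dvdE)
  \<comment> \<open>For \<open>r >= 1\<close> the argument \<open>- M / r\<close> stays in this
    interval.\<close>
  have "compact (poly B ` {- M..0})"
    by (intro compact_continuous_image continuous_intros compact_Icc)
  then obtain C where C: "\<forall>t\<in>{- M..0}. \<bar>poly B t\<bar> \<le> C"
    using compact_imp_bounded[of "poly B ` {- M..0}"] unfolding bounded_iff by auto
  have "\<bar>meval h (M *\<^sub>R e + r *\<^sub>R v)\<bar> \<le> (M ^ order 0 A * C) * r ^ k" if r: "r \<ge> 1" for r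
  proof -
    have "complex_of_real (meval h (M *\<^sub>R e + r *\<^sub>R v)) =
        ev (\<lambda>i. (- of_real r) * of_real ((- v + (- (M / r)) *\<^sub>R e) $ i)) h"
      unfolding of_real_meval using r
      by (intro arg_cong[where f = "\<lambda>x. ev x h"]) (auto simp: field_simps)
    also have "\<dots> = (- of_real r) ^ d * ev (\<lambda>i. of_real ((- v + (- (M / r)) *\<^sub>R e) $ i)) h"
      using r by (intro fhomD fhom) auto
    also have "\<dots> = of_real ((- r) ^ d * poly A (- (M / r)))"
      unfolding A_def poly_along by (simp add: of_real_meval)
    finally have "meval h (M *\<^sub>R e + r *\<^sub>R v) = (- r) ^ d * poly A (- (M / r))"
      by (simp only: of_real_eq_iff)
    then have "\<bar>meval h (M *\<^sub>R e + r *\<^sub>R v)\<bar> = r ^ d * (M / r) ^ order 0 A * \<bar>poly B (- (M / r))\<bar>"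
      using r assms by (subst (asm) B) (simp add: abs_mult power_abs)
    also have "\<dots> = r ^ k * M ^ order 0 A * \<bar>poly B (- (M / r))\<bar>"
      using r by (simp add: d power_add power_divide)
    also have "\<dots> \<le> r ^ k * M ^ order 0 A * C"
      using r assms by (intro mult_left_mono bspec[OF C]) (auto simp: field_simps)
    finally show ?thesis by (simp add: mult_ac)
  qed
  then show ?thesis using that[of "M ^ order 0 A * C"] by (simp add: k_def)
qed

lemma degree_along_le_hrank:
  assumes "v \<in> hyperbolicity_cone h e"
  shows "degree (along h w v) \<le> hrank h e v"
proof -
  obtain M where M: "M > 0" "\<And>r. r \<ge> 0 \<Longrightarrow>
      norm (H w (r *\<^sub>R v)) \<le> 27 ^ d * \<bar>meval h (M *\<^sub>R e + r *\<^sub>R v)\<bar>"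
    using H_le_meval[of w] assms by metis
  obtain C where C: "\<And>r. r \<ge> 1 \<Longrightarrow> \<bar>meval h (M *\<^sub>R e + r *\<^sub>R v)\<bar> \<le> C * r ^ hrank h e v"
    using meval_growth[OF M(1)] by blast
  have "degree (map_poly of_real (along h w v) :: complex poly) \<le> hrank h e v"
  proof (rule degree_le_of_growth)
    fix r :: real
    assume r: "r \<ge> 1"
    have "norm (H w (r *\<^sub>R v)) \<le> 27 ^ d * (C * r ^ hrank h e v)"
      by (rule order_trans[OF M(2) mult_left_mono[OF C]]) (use r in auto)
    then show "norm (poly (map_poly of_real (along h w v)) (\<i> * of_real r)) \<le>
        (27 ^ d * C) * r ^ hrank h e v"
      by (simp add: H_eq_poly_along mult.assoc)
  qed
  then show ?thesis by (simp add: degree_map_poly)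
qed

end

section \<open>Expectations over independent choices\<close>

text \<open>One coordinate is averaged at a time. \<open>override_on\<close> freezes the coordinates
  outside \<open>J\<close> at \<open>c\<close>; leaving \<open>c\<close> arbitrary lets the
  induction store the value \<open>a\<close> of the new coordinate there.\<close>

lemma sum_multiaffine:
  fixes g :: "('m \<Rightarrow> 'a::real_vector) \<Rightarrow> real"
  assumes "finite J"
    and "\<And>s j. g (s(j := \<Sum>a\<in>S j. p j a *\<^sub>R a)) = (\<Sum>a\<in>S j. p j a * g (s(j := a)))"
  shows "(\<Sum>s\<in>PiE J S. (\<Prod>j\<in>J. p j (s j)) * g (override_on c s J)) =
    g (override_on c (\<lambda>j. \<Sum>a\<in>S j. p j a *\<^sub>R a) J)"
  using assms(1)
proof (induction J arbitrary: c rule: finite_induct)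
  case empty
  then show ?case by simp
next
  case (insert j J)
  have "inj_on (\<lambda>(a, s). s(j := a)) (S j \<times> PiE J S)"
    using insert.hyps by (intro inj_combinator)
  then have "(\<Sum>s\<in>PiE (insert j J) S. (\<Prod>i\<in>insert j J. p i (s i)) * g (override_on c s (insert j J))) =
      (\<Sum>(a, s)\<in>S j \<times> PiE J S.
        (\<Prod>i\<in>insert j J. p i ((s(j := a)) i)) * g (override_on c (s(j := a)) (insert j J)))"
    unfolding PiE_insert_eq by (simp only: sum.reindex) (simp only: comp_def case_prod_unfold)
  also have "\<dots> = (\<Sum>(a, s)\<in>S j \<times> PiE J S.
      p j a * ((\<Prod>i\<in>J. p i (s i)) * g (override_on (c(j := a)) s J)))"
  proof (intro sum.cong refl, clarify)
    fix a s
    have "override_on c (s(j := a)) (insert j J) = override_on (c(j := a)) s J"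
      using insert.hyps by (auto simp: override_on_def fun_eq_iff)
    moreover have "(\<Prod>i\<in>J. p i ((s(j := a)) i)) = (\<Prod>i\<in>J. p i (s i))"
      using insert.hyps by (intro prod.cong) auto
    ultimately show "(\<Prod>i\<in>insert j J. p i ((s(j := a)) i)) * g (override_on c (s(j := a)) (insert j J)) =
        p j a * ((\<Prod>i\<in>J. p i (s i)) * g (override_on (c(j := a)) s J))"
      using insert.hyps by simp
  qed
  also have "\<dots> = (\<Sum>a\<in>S j. p j a * g (override_on (c(j := a)) (\<lambda>j. \<Sum>a\<in>S j. p j a *\<^sub>R a) J))"
    by (simp only: insert.IH flip: sum.cartesian_product sum_distrib_left)
  also have "\<dots> = (\<Sum>a\<in>S j. p j a * g ((override_on c (\<lambda>j. \<Sum>a\<in>S j. p j a *\<^sub>R a) J)(j := a)))"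
    using insert.hyps
    by (intro sum.cong refl arg_cong[where f = g] arg_cong2[where f = times]) (auto simp: override_on_def)
  also have "\<dots> = g ((override_on c (\<lambda>j. \<Sum>a\<in>S j. p j a *\<^sub>R a) J)(j := \<Sum>a\<in>S j. p j a *\<^sub>R a))"
    by (rule assms(2)[symmetric])
  also have "(override_on c (\<lambda>j. \<Sum>a\<in>S j. p j a *\<^sub>R a) J)(j := \<Sum>a\<in>S j. p j a *\<^sub>R a) =
      override_on c (\<lambda>j. \<Sum>a\<in>S j. p j a *\<^sub>R a) (insert j J)"
    by (auto simp: override_on_def)
  finally show ?case .
qed

lemma (in prob_space) sum_prob_finite_range:
  assumes "finite S" "random_variable (count_space S) X"
  shows "(\<Sum>a\<in>S. prob (X -` {a} \<inter> space M)) = 1"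
proof -
  have "(\<Sum>a\<in>S. prob (X -` {a} \<inter> space M)) = prob (\<Union>a\<in>S. X -` {a} \<inter> space M)"
    using assms by (intro finite_measure_finite_Union[symmetric])
      (auto simp: disjoint_family_on_def intro!: measurable_sets[OF assms(2)])
  also have "(\<Union>a\<in>S. X -` {a} \<inter> space M) = space M"
    using measurable_space[OF assms(2)] by auto
  finally show ?thesis by (simp add: prob_space)
qed

text \<open>The events \<open>E s\<close> partition the space, and independence factors their
  probabilities.\<close>

lemma (in prob_space) expectation_indep_finite:
  fixes X :: "'m::finite \<Rightarrow> 'a \<Rightarrow> 'b" and g :: "('m \<Rightarrow> 'b) \<Rightarrow> real"
  assumes fin: "\<And>j. finite (S j)"
    and ind: "indep_vars (\<lambda>j. count_space (S j)) X UNIV"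
  shows "expectation (\<lambda>\<omega>. g (\<lambda>j. X j \<omega>)) =
    (\<Sum>s\<in>PiE UNIV S. (\<Prod>j\<in>UNIV. prob (X j -` {s j} \<inter> space M)) * g s)"
proof -
  have rv: "random_variable (count_space (S j)) (X j)" for j
    using ind unfolding indep_vars_def2 by blast
  define E where "E s = (\<Inter>j\<in>UNIV. X j -` {s j} \<inter> space M)" for s
  have finPi: "finite (PiE UNIV S)" by (intro finite_PiE fin) auto
  have sets: "X j -` {s j} \<inter> space M \<in> events" if "s \<in> PiE UNIV S" for s j
    using that by (intro measurable_sets[OF rv]) auto
  then have events: "E s \<in> events" if "s \<in> PiE UNIV S" for s
    unfolding E_def using that by (intro sets.finite_INT) auto
  have "expectation (\<lambda>\<omega>. g (\<lambda>j. X j \<omega>)) = expectation (\<lambda>\<omega>. \<Sum>s\<in>PiE UNIV S. indicator (E s) \<omega> * g s)"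
  proof (intro Bochner_Integration.integral_cong refl)
    fix \<omega> assume \<omega>: "\<omega> \<in> space M"
    have mem: "(\<lambda>j. X j \<omega>) \<in> PiE UNIV S" using measurable_space[OF rv \<omega>] by auto
    have "(\<Sum>s\<in>PiE UNIV S. indicator (E s) \<omega> * g s) =
        (\<Sum>s\<in>PiE UNIV S. if s = (\<lambda>j. X j \<omega>) then g s else 0)"
    proof (intro sum.cong refl)
      fix s
      have "\<omega> \<in> E s \<longleftrightarrow> s = (\<lambda>j. X j \<omega>)" using \<omega> by (auto simp: E_def fun_eq_iff)
      then show "indicator (E s) \<omega> * g s = (if s = (\<lambda>j. X j \<omega>) then g s else 0)"
        by (simp only: indicator_def) simp
    qed
    then show "g (\<lambda>j. X j \<omega>) = (\<Sum>s\<in>PiE UNIV S. indicator (E s) \<omega> * g s)"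
      using mem finPi by simp
  qed
  also have "\<dots> = (\<Sum>s\<in>PiE UNIV S. prob (E s) * g s)"
  proof (subst Bochner_Integration.integral_sum)
    show "integrable M (\<lambda>\<omega>. indicator (E s) \<omega> * g s)" if "s \<in> PiE UNIV S" for s
      using events[OF that] by (intro integrable_mult_left integrable_real_indicator) (simp_all add: emeasure_eq_measure)
    show "(\<Sum>s\<in>PiE UNIV S. expectation (\<lambda>\<omega>. indicator (E s) \<omega> * g s)) =
        (\<Sum>s\<in>PiE UNIV S. prob (E s) * g s)"
      using events by (intro sum.cong refl) (simp add: sets.Int_space_eq2)
  qed
  also have "\<dots> = (\<Sum>s\<in>PiE UNIV S. (\<Prod>j\<in>UNIV. prob (X j -` {s j} \<inter> space M)) * g s)"
    unfolding E_def
    by (intro sum.cong refl arg_cong2[where f = times] indep_varsD_finite[OF ind]) auto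
  finally show ?thesis .
qed

text \<open>The random variables take values in the sets \<open>S j\<close>, so agreement on the
  product of these sets is enough. The rank hypothesis gives agreement only there.\<close>

lemma compatible_family_cong:
  fixes S :: "'m::finite \<Rightarrow> 'a set" and W :: "'w itself"
  assumes "\<And>s. s \<in> Pi UNIV S \<Longrightarrow> f s = f' s" "compatible_family W S f"
  shows "compatible_family W S f'"
proof -
  note family = assms(2)[unfolded compatible_family_def]
  show ?thesis
    unfolding compatible_family_def
  proof (intro conjI allI impI ballI)
    fix M :: "'w measure" and X :: "'m \<Rightarrow> 'w \<Rightarrow> 'a"
    assume M: "prob_space M" and ind: "prob_space.indep_vars M (\<lambda>j. count_space (S j)) X UNIV"
    then obtain q where q: "\<forall>t. poly q t = (\<integral>\<omega>. poly (f (\<lambda>j. X j \<omega>)) t \<partial>M)" "real_rooted q"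
      using family by blast
    have "X j \<in> measurable M (count_space (S j))" for j
      using ind unfolding prob_space.indep_vars_def2[OF M] by blast
    then have "X j \<omega> \<in> S j" if "\<omega> \<in> space M" for j \<omega>
      using measurable_space[of "X j" M "count_space (S j)" \<omega>] that by simp
    then have "(\<integral>\<omega>. poly (f (\<lambda>j. X j \<omega>)) t \<partial>M) = (\<integral>\<omega>. poly (f' (\<lambda>j. X j \<omega>)) t \<partial>M)" for t
      by (intro Bochner_Integration.integral_cong refl) (simp add: assms(1))
    with q show "\<exists>q. (\<forall>t. poly q t = (\<integral>\<omega>. poly (f' (\<lambda>j. X j \<omega>)) t \<partial>M)) \<and> real_rooted q"
      by (intro exI[of _ q]) simp
  next
    fix j
    show "finite (S j)" using family by blast
  next
    fix s s'
    assume "s \<in> Pi UNIV S" "s' \<in> Pi UNIV S" "f' s \<noteq> 0" "f' s' \<noteq> 0"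
    then show "degree (f' s) = degree (f' s')" "sgn (lead_coeff (f' s)) = sgn (lead_coeff (f' s'))"
      using family assms(1)[of s] assms(1)[of s'] by metis+
  qed
qed

text \<open>By affinity in each direction the expectation is the mixed polynomial of the mean
  vectors \<open>E j\<close>. These lie in \<open>N\<close>, so it is real-rooted.\<close>

lemma (in hyperbolic_pair) compatible_family_mixed:
  fixes V :: "'m::finite \<Rightarrow> (real ^ 'n) set" and w :: "real ^ ('n + 'm)"
  assumes fin: "\<And>j. finite (V j)" and cone: "\<And>j. V j \<subseteq> hyperbolicity_cone h e"
  shows "compatible_family TYPE('w) V (\<lambda>v. along (mixed h v) w (pad e))"
  unfolding compatible_family_def
proof (intro conjI allI impI ballI)
  fix M :: "'w measure" and X :: "'m \<Rightarrow> 'w \<Rightarrow> real ^ 'n"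
  assume M: "prob_space M" and ind: "prob_space.indep_vars M (\<lambda>j. count_space (V j)) X UNIV"
  interpret prob_space M by (rule M)
  define p where "p j a = prob (X j -` {a} \<inter> space M)" for j a
  define E where "E j = (\<Sum>a\<in>V j. p j a *\<^sub>R a)" for j
  have sum1: "(\<Sum>a\<in>V j. p j a) = 1" for j
    unfolding p_def using ind fin
    by (intro sum_prob_finite_range) (auto simp: indep_vars_def2)
  have "E j \<in> N" for j
    unfolding E_def p_def using cone cone_subset_N by (intro N_sum N_scaleR) auto
  then have "real_rooted (along (mixed h E) w (pad e))" by (rule real_rooted_mixed)
  moreover have "poly (along (mixed h E) w (pad e)) t =
      (\<integral>\<omega>. poly (along (mixed h (\<lambda>j. X j \<omega>)) w (pad e)) t \<partial>M)" for t
  proof -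
    let ?g = "\<lambda>v. meval (mixed h v) (w + t *\<^sub>R pad e)"
    have "(\<integral>\<omega>. ?g (\<lambda>j. X j \<omega>) \<partial>M) = (\<Sum>s\<in>PiE UNIV V. (\<Prod>j\<in>UNIV. p j (s j)) * ?g s)"
      unfolding p_def using fin ind by (rule expectation_indep_finite)
    also have "\<dots> = ?g E"
      \<comment> \<open>The base point \<open>undefined\<close> is overwritten in every
        coordinate.\<close>
      using sum_multiaffine[of UNIV ?g p V undefined, OF finite meval_mixed_average[OF sum1]]
      by (simp add: E_def[abs_def] override_on_def)
    finally show ?thesis by (simp add: poly_along)
  qed
  ultimately show "\<exists>q. (\<forall>t. poly q t =
      (\<integral>\<omega>. poly (along (mixed h (\<lambda>j. X j \<omega>)) w (pad e)) t \<partial>M)) \<and> real_rooted q"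
    by blast
next
  fix s s' :: "'m \<Rightarrow> real ^ 'n"
  show "sgn (lead_coeff (along (mixed h s) w (pad e))) =
      sgn (lead_coeff (along (mixed h s') w (pad e)))"
    by (simp only: lead_coeff_mixed)
qed (simp_all add: fin degree_mixed)

theorem theorem3p5:
  fixes h :: "'n::finite rpoly" and e :: "real ^ 'n"
    and V :: "'m::finite \<Rightarrow> (real ^ 'n) set"
  assumes "hyperbolic h e"
    and "\<And>j. finite (V j)"
    and "\<And>j. V j \<subseteq> hyperbolicity_cone h e"
  shows "(\<forall>w :: real ^ ('n + 'm).
            compatible_family TYPE('w) V (\<lambda>v. along (mixed h v) w (pad e))) \<and>
         ((\<forall>j. \<forall>v\<in>V j. hrank h e v \<le> 1) \<longrightarrow>
          (\<forall>(w :: real ^ 'n) (\<alpha> :: real ^ 'm).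
            compatible_family TYPE('w) V (\<lambda>v. along h (w - (\<Sum>j\<in>UNIV. \<alpha> $ j *\<^sub>R v j)) e)))"
proof -
  obtain d where "homogeneous d h" using assms(1) by (auto simp: hyperbolic_def)
  with assms(1) interpret hyperbolic_pair h e d
    by unfold_locales (auto simp: hyperbolic_def)
  have family: "compatible_family TYPE('w) V (\<lambda>v. along (mixed h v) w (pad e))"
    for w :: "real ^ ('n + 'm)"
    using assms(2,3) by (rule compatible_family_mixed)
  moreover have "compatible_family TYPE('w) V (\<lambda>v. along h (w - (\<Sum>j\<in>UNIV. \<alpha> $ j *\<^sub>R v j)) e)"
    if rank: "\<forall>j. \<forall>v\<in>V j. hrank h e v \<le> 1" for w and \<alpha> :: "real ^ 'm"
  proof (rule compatible_family_cong[OF _ family])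
    \<comment> \<open>With \<open>\<alpha>\<close> as the values of the auxiliary variables, the
      translations produced by the mixing operators are exactly those of the second family.\<close>
    let ?w = "\<chi> i. case i of Inl k \<Rightarrow> w $ k | Inr j \<Rightarrow> \<alpha> $ j"
    fix v
    assume v: "v \<in> Pi UNIV V"
    have "degree (along h x (v j)) \<le> 1" for x j
    proof -
      have "v j \<in> V j" using v by auto
      then show ?thesis
        using degree_along_le_hrank[of "v j" x] assms(3)[of j] rank by (meson order_trans subsetD)
    qed
    then have *: "meval (mixed h v) x = meval h ((\<chi> k. x $ Inl k) - (\<Sum>j\<in>UNIV. x $ Inr j *\<^sub>R v j))" for x
      by (rule meval_mixed_affine)
    show "along (mixed h v) ?w (pad e) = along h (w - (\<Sum>j\<in>UNIV. \<alpha> $ j *\<^sub>R v j)) e"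
    proof (rule poly_eq_poly_eq_iff[THEN iffD1], rule ext)
      fix t
      have "(\<chi> k. (?w + t *\<^sub>R pad e) $ Inl k) - (\<Sum>j\<in>UNIV. (?w + t *\<^sub>R pad e) $ Inr j *\<^sub>R v j) =
          w - (\<Sum>j\<in>UNIV. \<alpha> $ j *\<^sub>R v j) + t *\<^sub>R e"
        by (simp add: vec_eq_iff pad_def)
      then show "poly (along (mixed h v) ?w (pad e)) t =
          poly (along h (w - (\<Sum>j\<in>UNIV. \<alpha> $ j *\<^sub>R v j)) e) t"
        by (simp only: poly_along *)
    qed
  qed
  ultimately show ?thesis by blast
qed

end
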